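(* Assume that there exists $\alpha^*\in[0,1)$ such that for all $\alpha\in(\alpha^*,1]$: (i) the function $x\mapsto\mathbb{E}[h_\alpha(x-D)]$ is quasiconvex on $\mathbb{X}$; and (ii) $\lim_{x\to-\infty}\mathbb{E}[h_\alpha(x-D)]>K+\inf_{x\in\mathbb{X}}\mathbb{E}[h_\alpha(x-D)]$. Then for each $\beta\in(\alpha^*,1)$ the family of functions $\{u_\alpha\}_{\alpha\in[\beta,1)}$ is equicontinuous on $\mathbb{X}$.
   Context: Inventory model. Either (a) $\mathbb{X}=\mathbb{R}$ (states) and $\mathbb{A}=[0,+\infty)$ (actions), or (b) $\mathbb{X}=\mathbb{Z}$, $\mathbb{A}=\{0,1,2,\ldots\}$ and the demand is integer valued. Constants $K>0$ (fixed ordering cost), $\bar c>0$ (unit ordering cost). $D_1,D_2,\ldots$ are i.i.d. nonnegative finite random variables, $D$ has the same distribution as $D_1$, $\mathbb{E}[D]<+\infty$, $P(D>0)>0$. The holding/backlog cost function $h$ is such that $x\mapsto\mathbb{E}[h(x-D)]$ is finite, continuous and nonnegative on $\mathbb{X}$ and $\mathbb{E}[h(x-D)]\to+\infty$ as $|x|\to+\infty$. Dynamics: $x_{t+1}=x_t+a_t-D_{t+1}$, $t=0,1,\ldots$. One-step cost: $c(x,a)=K\mathbf{1}_{\{a>0\}}+\bar c a+\mathbb{E}[h(x+a-D)]$. Policies may be randomized and history-dependent; $\mathbb{E}_x^\pi$ is the expectation for initial state $x$ and policy $\pi$. $v_\alpha^\pi(x)=\mathbb{E}_x^\pi[\sum_{t=0}^\infty\alpha^t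 c(x_t,a_t)]$ and $v_\alpha(x)=\inf_\pi v^\pi_\alpha(x)$ for $\alpha\in[0,1)$; $m_\alpha:=\inf_{x\in\mathbb{X}}v_\alpha(x)$, $u_\alpha(x):=v_\alpha(x)-m_\alpha$. For $\alpha\in(0,1]$: $h_\alpha(x):=h(x)+(1-\alpha)\bar c x+\bar c\,\mathbb{E}[D]$. A function $f$ is quasiconvex if $f(\lambda x+(1-\lambda)y)\le\max\{f(x),f(y)\}$ for all $x,y$ and $\lambda\in[0,1]$ (if $\mathbb{X}=\mathbb{Z}$, whenever $x,y,\lambda x+(1-\lambda)y\in\mathbb{Z}$). A family $\mathcal{H}$ of real-valued functions on a metric space $X$ is equicontinuous at $x$ if for each $\varepsilon>0$ there is an open set $G\ni x$ with $|f(y)-f(x)|<\varepsilon$ for all $y\in G$ and all $f\in\mathcal{H}$; it is equicontinuous on $X$ if it is so at every $x\in X$. *)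

theory Defs
  imports "HOL-Probability.Probability"
begin

section \<open>Discounted Markov decision processes\<close>

text \<open>
  Time \<open>t\<close> of a trajectory carries the pair \<open>(x\<^sub>t, a\<^sub>t)\<close>.  A policy is a sequence of transition
  probabilities: \<open>\<pi> t\<close> maps the history \<open>((x\<^sub>0, a\<^sub>0), \<dots>, (x\<^bsub>t-1\<^esub>, a\<^bsub>t-1\<^esub>))\<close> together with
  the current state \<open>x\<^sub>t\<close> to a distribution on actions.  All actions are available in all states.
\<close>

definition policies ::
  "'s measure \<Rightarrow> 'a measure \<Rightarrow> (nat \<Rightarrow> (nat \<Rightarrow> 's \<times> 'a) \<times> 's \<Rightarrow> 'a measure) set" where
  "policies S A =
     {\<pi>. \<forall>t. \<pi> t \<in> (PiM {0..<t} (\<lambda>_. S \<Otimes>\<^sub>M A) \<Otimes>\<^sub>M S) \<rightarrow>\<^sub>M prob_algebra A}"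

text \<open>
  Given the past \<open>\<omega>\<close>, the state at time \<open>t\<close> is the fixed \<open>x\<close> if \<open>t = 0\<close> and has law
  \<open>q (x\<^bsub>t-1\<^esub>, a\<^bsub>t-1\<^esub>)\<close> otherwise; the action is then drawn from the policy.
\<close>

definition mdp_kernel ::
  "'s measure \<Rightarrow> 'a measure \<Rightarrow> ('s \<times> 'a \<Rightarrow> 's measure) \<Rightarrow>
   (nat \<Rightarrow> (nat \<Rightarrow> 's \<times> 'a) \<times> 's \<Rightarrow> 'a measure) \<Rightarrow> 's \<Rightarrow>
   nat \<Rightarrow> (nat \<Rightarrow> 's \<times> 'a) \<Rightarrow> ('s \<times> 'a) measure" where
  "mdp_kernel S A q \<pi> x t \<omega> =
     (if t = 0 then return S x else q (\<omega> (t - 1))) \<bind>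
       (\<lambda>y. distr (\<pi> t (\<omega>, y)) (S \<Otimes>\<^sub>M A) (\<lambda>a. (y, a)))"

text \<open>The law of the trajectory, given by the theorem of Ionescu Tulcea.\<close>

definition mdp_law ::
  "'s measure \<Rightarrow> 'a measure \<Rightarrow> ('s \<times> 'a \<Rightarrow> 's measure) \<Rightarrow>
   (nat \<Rightarrow> (nat \<Rightarrow> 's \<times> 'a) \<times> 's \<Rightarrow> 'a measure) \<Rightarrow> 's \<Rightarrow> (nat \<Rightarrow> 's \<times> 'a) measure" where
  "mdp_law S A q \<pi> x =
     projective_family.lim UNIV
       (Ionescu_Tulcea.CI (mdp_kernel S A q \<pi> x) (\<lambda>_. S \<Otimes>\<^sub>M A)) (\<lambda>_. S \<Otimes>\<^sub>M A)"

lemma mdp_Ionescu_Tulcea: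
  assumes "\<pi> \<in> policies S A" and q: "q \<in> S \<Otimes>\<^sub>M A \<rightarrow>\<^sub>M prob_algebra S" and x: "x \<in> space S"
  shows "Ionescu_Tulcea (mdp_kernel S A q \<pi> x) (\<lambda>_. S \<Otimes>\<^sub>M A)"
proof -
  have \<pi>[measurable]: "\<pi> t \<in> (PiM {0..<t} (\<lambda>_. S \<Otimes>\<^sub>M A) \<Otimes>\<^sub>M S) \<rightarrow>\<^sub>M prob_algebra A" for t
    using assms(1) by (auto simp: policies_def)
  have state: "(\<lambda>\<omega>. if t = 0 then return S x else q (\<omega> (t - 1)))
      \<in> PiM {0..<t} (\<lambda>_. S \<Otimes>\<^sub>M A) \<rightarrow>\<^sub>M prob_algebra S" for t :: nat
  proof (cases "t = 0")
    case True
    have "return S x \<in> space (prob_algebra S)"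
      using x by (simp add: space_prob_algebra prob_space_return)
    with True show ?thesis by simp
  next
    case False
    then have "t - 1 \<in> {0..<t}" by auto
    then have "(\<lambda>\<omega>. q (\<omega> (t - 1))) \<in> PiM {0..<t} (\<lambda>_. S \<Otimes>\<^sub>M A) \<rightarrow>\<^sub>M prob_algebra S"
      by (intro measurable_compose[OF _ q] measurable_component_singleton)
    with False show ?thesis by simp
  qed
  have kernel: "mdp_kernel S A q \<pi> x t \<in>
      PiM {0..<t} (\<lambda>_. S \<Otimes>\<^sub>M A) \<rightarrow>\<^sub>M prob_algebra (S \<Otimes>\<^sub>M A)" for t
    unfolding mdp_kernel_def[abs_def]
    by (rule measurable_bind_prob_space2[OF state]) measurable
  show ?thesis
    using kernel[THEN measurable_prob_algebraD] measurable_space[OF kernel]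
    by (intro Ionescu_Tulcea.intro) (simp_all add: space_prob_algebra)
qed

text \<open>The costs are meant to be nonnegative: \<^const>\<open>ennreal\<close> truncates negative numbers to 0.\<close>

definition discounted_cost ::
  "'s measure \<Rightarrow> 'a measure \<Rightarrow> ('s \<times> 'a \<Rightarrow> 's measure) \<Rightarrow> ('s \<times> 'a \<Rightarrow> real) \<Rightarrow> real \<Rightarrow>
   (nat \<Rightarrow> (nat \<Rightarrow> 's \<times> 'a) \<times> 's \<Rightarrow> 'a measure) \<Rightarrow> 's \<Rightarrow> ennreal" where
  "discounted_cost S A q c \<alpha> \<pi> x =
     (\<integral>\<^sup>+\<omega>. (\<Sum>t. ennreal (\<alpha> ^ t * c (\<omega> t))) \<partial>mdp_law S A q \<pi> x)"

definition discounted_value ::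
  "'s measure \<Rightarrow> 'a measure \<Rightarrow> ('s \<times> 'a \<Rightarrow> 's measure) \<Rightarrow> ('s \<times> 'a \<Rightarrow> real) \<Rightarrow> real \<Rightarrow>
   's \<Rightarrow> ennreal" where
  "discounted_value S A q c \<alpha> x = (INF \<pi>\<in>policies S A. discounted_cost S A q c \<alpha> \<pi> x)"


section \<open>Quasiconvexity and equicontinuity\<close>

definition quasiconvex_on :: "real set \<Rightarrow> (real \<Rightarrow> real) \<Rightarrow> bool" where
  "quasiconvex_on S f \<longleftrightarrow>
     (\<forall>x\<in>S. \<forall>y\<in>S. \<forall>l\<in>{0..1}. l * x + (1 - l) * y \<in> S \<longrightarrow>
        f (l * x + (1 - l) * y) \<le> max (f x) (f y))"

definition equicontinuous_at_within :: "'a::metric_space set \<Rightarrow> ('a \<Rightarrow> real) set \<Rightarrow> 'a \<Rightarrow> bool" where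
  "equicontinuous_at_within S F x \<longleftrightarrow>
     (\<forall>e>0. \<exists>G. openin (top_of_set S) G \<and> x \<in> G \<and> (\<forall>y\<in>G. \<forall>f\<in>F. \<bar>f y - f x\<bar> < e))"

definition equicontinuous_on :: "'a::metric_space set \<Rightarrow> ('a \<Rightarrow> real) set \<Rightarrow> bool" where
  "equicontinuous_on S F \<longleftrightarrow> (\<forall>x\<in>S. equicontinuous_at_within S F x)"


section \<open>The inventory model\<close>

text \<open>
  Both the real and the integer model live inside \<^typ>\<open>real\<close>; \<open>X\<close> is the set of states and \<open>A\<close> the
  set of actions.  In the integer model only the values of \<open>h\<close> on \<^term>\<open>\<int>\<close> matter.
  The demands are \<open>D 1, D 2, \<dots>\<close>; the value of \<open>D 0\<close> is irrelevant.
\<close>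

locale inventory_model = prob_space M for M :: "'w measure" +
  fixes D :: "nat \<Rightarrow> 'w \<Rightarrow> real"
    and X A :: "real set"
    and K cbar :: real
    and h :: "real \<Rightarrow> real"
  assumes real_or_integer:
      "(X = UNIV \<and> A = {0..}) \<or>
       (X = \<int> \<and> A = \<nat> \<and> (\<forall>n\<ge>1. \<forall>\<omega>\<in>space M. D n \<omega> \<in> \<int>))"
    and K_pos: "K > 0"
    and cbar_pos: "cbar > 0"
    and D_indep: "indep_vars (\<lambda>_. borel) D {1..}"
    and D_ident: "\<And>n. n \<ge> 1 \<Longrightarrow> distr M borel (D n) = distr M borel (D 1)"
    and D_nonneg: "\<And>n \<omega>. n \<ge> 1 \<Longrightarrow> \<omega> \<in> space M \<Longrightarrow> D n \<omega> \<ge> 0"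
    and D_integrable: "integrable M (D 1)"
    and D_nontrivial: "prob {\<omega> \<in> space M. D 1 \<omega> > 0} > 0"
    and holding_finite: "\<And>x. x \<in> X \<Longrightarrow> integrable M (\<lambda>\<omega>. h (x - D 1 \<omega>))"
    and holding_continuous: "continuous_on X (\<lambda>x. expectation (\<lambda>\<omega>. h (x - D 1 \<omega>)))"
    and holding_nonneg: "\<And>x. x \<in> X \<Longrightarrow> expectation (\<lambda>\<omega>. h (x - D 1 \<omega>)) \<ge> 0"
    and holding_coercive:
      "filterlim (\<lambda>x. expectation (\<lambda>\<omega>. h (x - D 1 \<omega>))) at_top (inf at_infinity (principal X))"
begin

definition state_space :: "real measure" where
  "state_space = restrict_space borel X"

definition action_space :: "real measure" where
  "action_space = restrict_space borel A"

text \<open>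
  The law of \<open>x\<^bsub>t+1\<^esub> = x\<^sub>t + a\<^sub>t - D\<^bsub>t+1\<^esub>\<close> given \<open>(x\<^sub>t, a\<^sub>t)\<close>: as the demands are i.i.d.,
  \<open>D\<^bsub>t+1\<^esub>\<close> is independent of the past and has the law of \<open>D 1\<close>.
\<close>

definition transition :: "real \<times> real \<Rightarrow> real measure" where
  "transition = (\<lambda>(x, a). distr M state_space (\<lambda>\<omega>. x + a - D 1 \<omega>))"

definition step_cost :: "real \<times> real \<Rightarrow> real" where
  "step_cost = (\<lambda>(x, a).
     (if a > 0 then K else 0) + cbar * a + expectation (\<lambda>\<omega>. h (x + a - D 1 \<omega>)))"

definition v :: "real \<Rightarrow> real \<Rightarrow> ennreal" where
  "v \<alpha> x = discounted_value state_space action_space transition step_cost \<alpha> x"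

definition m :: "real \<Rightarrow> ennreal" where
  "m \<alpha> = (INF x\<in>X. v \<alpha> x)"

text \<open>
  For \<open>0 \<le> \<alpha> < 1\<close> no infinite value is converted to 0 here: ordering nothing at time 0 and
  \<open>a\<^sub>t = D\<^sub>t\<close> at times \<open>t \<ge> 1\<close>, so that \<open>x\<^sub>t + a\<^sub>t = x\<^sub>0\<close> always, has finite
  expected discounted cost, hence \<open>m \<alpha> \<le> v \<alpha> x < \<infinity>\<close>.
\<close>

definition u :: "real \<Rightarrow> real \<Rightarrow> real" where
  "u \<alpha> x = enn2real (v \<alpha> x) - enn2real (m \<alpha>)"

definition h_disc :: "real \<Rightarrow> real \<Rightarrow> real" where
  "h_disc \<alpha> x = h x + (1 - \<alpha>) * cbar * x + cbar * expectation (D 1)"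

definition expected_h_disc :: "real \<Rightarrow> real \<Rightarrow> real" where
  "expected_h_disc \<alpha> x = expectation (\<lambda>\<omega>. h_disc \<alpha> (x - D 1 \<omega>))"

lemma D_measurable [measurable]: "D 1 \<in> borel_measurable M"
  using D_integrable by (rule borel_measurable_integrable)

lemma transition_measurable:
  "transition \<in> state_space \<Otimes>\<^sub>M action_space \<rightarrow>\<^sub>M prob_algebra state_space"
proof -
  have mem: "x + a - D 1 \<omega> \<in> X" if "x \<in> X" "a \<in> A" "\<omega> \<in> space M" for x a \<omega>
    using real_or_integer that by (auto simp: Nats_subset_Ints[THEN subsetD])
  have S: "(\<lambda>x. x) \<in> state_space \<rightarrow>\<^sub>M borel" and A: "(\<lambda>x. x) \<in> action_space \<rightarrow>\<^sub>M borel"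
    unfolding state_space_def action_space_def by (simp_all add: measurable_restrict_space1)
  have [measurable]: "(\<lambda>z. fst (fst z)) \<in> (state_space \<Otimes>\<^sub>M action_space) \<Otimes>\<^sub>M M \<rightarrow>\<^sub>M borel"
      "(\<lambda>z. snd (fst z)) \<in> (state_space \<Otimes>\<^sub>M action_space) \<Otimes>\<^sub>M M \<rightarrow>\<^sub>M borel"
    by (rule measurable_compose[OF measurable_compose[OF measurable_fst measurable_fst] S]
             measurable_compose[OF measurable_compose[OF measurable_fst measurable_snd] A])+
  have "(\<lambda>((x, a), \<omega>). x + a - D 1 \<omega>) \<in> (state_space \<Otimes>\<^sub>M action_space) \<Otimes>\<^sub>M M \<rightarrow>\<^sub>M borel"
    unfolding split_beta' by measurable
  then have "(\<lambda>((x, a), \<omega>). x + a - D 1 \<omega>) \<in>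
      (state_space \<Otimes>\<^sub>M action_space) \<Otimes>\<^sub>M M \<rightarrow>\<^sub>M state_space"
    unfolding state_space_def
    by (intro measurable_restrict_space2)
       (auto simp: space_pair_measure space_restrict_space action_space_def intro: mem
             simp del: One_nat_def)
  then have "(\<lambda>z. distr M state_space (\<lambda>\<omega>. fst z + snd z - D 1 \<omega>)) \<in>
      state_space \<Otimes>\<^sub>M action_space \<rightarrow>\<^sub>M prob_algebra state_space"
    by (intro measurable_distr_prob_space2)
       (auto simp: split_beta' space_prob_algebra prob_space_axioms)
  then show ?thesis
    by (simp add: transition_def split_beta')
qed

end

end

theory Submission
  imports Defs
begin

text \<open>
  The integers are discrete, so only real states matter.  Writing \<open>y\<^sub>t = x\<^sub>t + a\<^sub>t\<close>, the unit ordering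
  costs telescope, and the total cost becomes that of a problem without unit cost whose holding cost is
  \<open>expected_h_disc \<alpha>\<close>.  Shift it by its minimum, attained at \<open>S\<close>, to get \<open>F \<ge> 0\<close>.  By quasiconvexity
  \<open>F\<close> decreases on the left of \<open>S\<close> and increases on the right, and by compactness of \<open>[\<beta>, 1]\<close> there is a
  \<open>b\<close>, the same for all \<open>\<alpha>\<close>, with \<open>F \<ge> K\<close> on the left of \<open>b\<close>.  Hence below \<open>b\<close> ordering is optimal, and the
  value is constant there.  From two nearby states, copying orders whenever possible keeps the states
  close until the larger one falls below \<open>b\<close>; the expected number of periods until then is bounded
  by a linear function of the state, uniformly in \<open>\<alpha>\<close>, and each period costs at most the oscillation of
  \<open>F\<close> on a compact interval.  This yields a modulus of continuity, by induction along value iteration.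
\<close>

section \<open>The law of a controlled trajectory\<close>

text \<open>Here \<open>up_to {0..<n}\<close> is exactly \<open>n\<close>, so the marginal of the
  limit on an initial segment is the composed kernel \<open>C 0 n\<close> itself, without a further
  projection.\<close>

lemma (in Ionescu_Tulcea) distr_lim_atLeastLessThan:
  "distr PF.lim (PiM {0..<n} M) (\<lambda>\<omega>. restrict \<omega> {0..<n}) = C 0 n (\<lambda>_. undefined)"
proof -
  have "up_to {0..<n} \<le> n"
    by (simp add: up_to_iff)
  moreover have "{0..<n} \<subseteq> {0..<up_to {0..<n}}"
    by (rule up_to) simp
  ultimately have "up_to {0..<n} = n"
    by (cases "n = 0") (auto simp: ivl_subset)
  then show ?thesis
    using distr_C[of n n "\<lambda>_. undefined" 0]
    by (subst distr_lim) (auto simp: CI_def space_PiM)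
qed

lemma (in Ionescu_Tulcea) nn_integral_lim_component:
  assumes [measurable]: "f \<in> borel_measurable (M n)"
  shows "(\<integral>\<^sup>+\<omega>. f (\<omega> n) \<partial>PF.lim) = (\<integral>\<^sup>+\<omega>. f (\<omega> n) \<partial>C 0 (Suc n) (\<lambda>_. undefined))"
proof -
  have "(\<integral>\<^sup>+\<omega>. f (\<omega> n) \<partial>C 0 (Suc n) (\<lambda>_. undefined)) =
      (\<integral>\<^sup>+\<omega>. f (restrict \<omega> {0..<Suc n} n) \<partial>PF.lim)"
    unfolding distr_lim_atLeastLessThan[symmetric]
    by (rule nn_integral_distr)
       (auto intro!: measurable_restrict measurable_component_singleton measurable_compose[OF _ assms]
         simp: measurable_cong_sets[OF PF.sets_lim refl])
  then show ?thesis by simp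
qed

text \<open>The last factor of the composition is a bind with the one-step extension
  \<open>eP n\<close>, so a function of the newest coordinate is integrated by conditioning on the
  past.\<close>

lemma (in Ionescu_Tulcea) nn_integral_C_Suc:
  assumes [measurable]: "f \<in> borel_measurable (M n)"
  shows "(\<integral>\<^sup>+\<omega>. f (\<omega> n) \<partial>C 0 (Suc n) (\<lambda>_. undefined)) =
    (\<integral>\<^sup>+\<omega>. (\<integral>\<^sup>+z. f z \<partial>P n \<omega>) \<partial>C 0 n (\<lambda>_. undefined))"
proof -
  have f: "(\<lambda>\<omega>. f (\<omega> n)) \<in> borel_measurable (PiM {0..<Suc n} M)"
    by (rule measurable_compose[OF _ assms]) (rule measurable_component_singleton, simp)
  have u: "(\<lambda>_. undefined) \<in> space (PiM {0..<0} M)"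
    by (simp add: space_PiM)
  have "(\<integral>\<^sup>+\<omega>. f (\<omega> n) \<partial>C 0 (Suc n) (\<lambda>_. undefined)) =
      (\<integral>\<^sup>+\<omega>. (\<integral>\<^sup>+\<omega>'. f (\<omega>' n) \<partial>eP n \<omega>) \<partial>C 0 n (\<lambda>_. undefined))"
    using measurable_eP[of n] u
    by (simp add: nn_integral_bind[OF f] measurable_cong_sets[OF sets_C[OF u] refl])
  also have "\<dots> = (\<integral>\<^sup>+\<omega>. (\<integral>\<^sup>+z. f z \<partial>P n \<omega>) \<partial>C 0 n (\<lambda>_. undefined))"
    by (intro nn_integral_cong) (simp add: nn_integral_eP f space_C[OF u])
  finally show ?thesis .
qed

section \<open>The trajectory under one fixed policy\<close>

locale mdp_trajectory =
  fixes S :: "'s measure" and A :: "'a measure" and q :: "'s \<times> 'a \<Rightarrow> 's measure"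
    and \<pi> :: "nat \<Rightarrow> (nat \<Rightarrow> 's \<times> 'a) \<times> 's \<Rightarrow> 'a measure" and x :: 's
  assumes policy: "\<pi> \<in> policies S A"
    and q: "q \<in> S \<Otimes>\<^sub>M A \<rightarrow>\<^sub>M prob_algebra S"
    and x: "x \<in> space S"
begin

sublocale Ionescu_Tulcea "mdp_kernel S A q \<pi> x" "\<lambda>_. S \<Otimes>\<^sub>M A"
  using policy q x by (rule mdp_Ionescu_Tulcea)

abbreviation law where "law \<equiv> mdp_law S A q \<pi> x"

lemma sets_law [measurable_cong]: "sets law = sets (PiM UNIV (\<lambda>_. S \<Otimes>\<^sub>M A))"
  unfolding mdp_law_def by (rule PF.sets_lim)

lemma policy_measurable [measurable]:
  "\<pi> t \<in> (PiM {0..<t} (\<lambda>_. S \<Otimes>\<^sub>M A) \<Otimes>\<^sub>M S) \<rightarrow>\<^sub>M prob_algebra A"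
  using policy by (auto simp: policies_def)

text \<open>The first factor of \<open>mdp_kernel\<close>, named so that the law of the state can be
  handled apart from that of the action.\<close>

definition state_kernel :: "nat \<Rightarrow> (nat \<Rightarrow> 's \<times> 'a) \<Rightarrow> 's measure" where
  "state_kernel t \<omega> = (if t = 0 then return S x else q (\<omega> (t - 1)))"

lemma state_kernel_measurable:
  "state_kernel t \<in> PiM {0..<t} (\<lambda>_. S \<Otimes>\<^sub>M A) \<rightarrow>\<^sub>M prob_algebra S"
proof (cases "t = 0")
  case True
  have "return S x \<in> space (prob_algebra S)"
    using x by (simp add: space_prob_algebra prob_space_return)
  with True show ?thesis by (simp add: state_kernel_def[abs_def])
next
  case False
  then have "t - 1 \<in> {0..<t}" by auto
  then have "(\<lambda>\<omega>. q (\<omega> (t - 1))) \<in> PiM {0..<t} (\<lambda>_. S \<Otimes>\<^sub>M A) \<rightarrow>\<^sub>M prob_algebra S"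
    by (intro measurable_compose[OF _ q] measurable_component_singleton)
  with False show ?thesis by (simp add: state_kernel_def[abs_def])
qed

lemma nn_integral_mdp_kernel:
  assumes \<omega>: "\<omega> \<in> space (PiM {0..<t} (\<lambda>_. S \<Otimes>\<^sub>M A))"
    and [measurable]: "f \<in> borel_measurable (S \<Otimes>\<^sub>M A)"
  shows "(\<integral>\<^sup>+z. f z \<partial>mdp_kernel S A q \<pi> x t \<omega>) =
    (\<integral>\<^sup>+y. (\<integral>\<^sup>+a. f (y, a) \<partial>\<pi> t (\<omega>, y)) \<partial>state_kernel t \<omega>)"
proof -
  have sk: "sets (state_kernel t \<omega>) = sets S"
    using measurable_space[OF state_kernel_measurable \<omega>] by (simp add: space_prob_algebra)
  note [measurable] = \<omega>
  have k: "(\<lambda>y. distr (\<pi> t (\<omega>, y)) (S \<Otimes>\<^sub>M A) (\<lambda>a. (y, a))) \<in> S \<rightarrow>\<^sub>M prob_algebra (S \<Otimes>\<^sub>M A)"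
    by measurable
  have "(\<integral>\<^sup>+z. f z \<partial>mdp_kernel S A q \<pi> x t \<omega>) =
      (\<integral>\<^sup>+y. (\<integral>\<^sup>+z. f z \<partial>distr (\<pi> t (\<omega>, y)) (S \<Otimes>\<^sub>M A) (\<lambda>a. (y, a))) \<partial>state_kernel t \<omega>)"
    unfolding mdp_kernel_def state_kernel_def[symmetric]
    using measurable_prob_algebraD[OF k]
    by (intro nn_integral_bind[where B="S \<Otimes>\<^sub>M A"]) (simp_all add: measurable_cong_sets[OF sk refl])
  also have "\<dots> = (\<integral>\<^sup>+y. (\<integral>\<^sup>+a. f (y, a) \<partial>\<pi> t (\<omega>, y)) \<partial>state_kernel t \<omega>)"
  proof (intro nn_integral_cong)
    fix y assume "y \<in> space (state_kernel t \<omega>)"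
    then have y: "y \<in> space S" using sets_eq_imp_space_eq[OF sk] by simp
    then have "\<pi> t (\<omega>, y) \<in> space (prob_algebra A)"
      using measurable_space[OF policy_measurable, of "(\<omega>, y)" t] \<omega> by (simp add: space_pair_measure)
    then have s: "sets (\<pi> t (\<omega>, y)) = sets A" by (simp add: space_prob_algebra)
    show "(\<integral>\<^sup>+z. f z \<partial>distr (\<pi> t (\<omega>, y)) (S \<Otimes>\<^sub>M A) (\<lambda>a. (y, a))) = (\<integral>\<^sup>+a. f (y, a) \<partial>\<pi> t (\<omega>, y))"
      using y by (intro nn_integral_distr) (simp_all add: measurable_cong_sets[OF s refl])
  qed
  finally show ?thesis .
qed

lemma prob_space_policy:
  assumes "\<omega> \<in> space (PiM {0..<t} (\<lambda>_. S \<Otimes>\<^sub>M A))" "y \<in> space S"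
  shows "prob_space (\<pi> t (\<omega>, y))"
  using measurable_space[OF policy_measurable, of "(\<omega>, y)" t] assms
  by (simp add: space_pair_measure space_prob_algebra)

lemma nn_integral_state_action:
  assumes [measurable]: "f \<in> borel_measurable (S \<Otimes>\<^sub>M A)"
  shows "(\<integral>\<^sup>+\<omega>. f (\<omega> t) \<partial>law) =
    (\<integral>\<^sup>+\<omega>. (\<integral>\<^sup>+y. (\<integral>\<^sup>+a. f (y, a) \<partial>\<pi> t (\<omega>, y)) \<partial>state_kernel t \<omega>) \<partial>C 0 t (\<lambda>_. undefined))"
proof -
  have u: "(\<lambda>_. undefined) \<in> space (PiM {0..<0::nat} (\<lambda>_. S \<Otimes>\<^sub>M A))"
    by (simp add: space_PiM)
  have "(\<integral>\<^sup>+\<omega>. f (\<omega> t) \<partial>law) =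
      (\<integral>\<^sup>+\<omega>. (\<integral>\<^sup>+z. f z \<partial>mdp_kernel S A q \<pi> x t \<omega>) \<partial>C 0 t (\<lambda>_. undefined))"
    unfolding mdp_law_def using nn_integral_lim_component[of f t] nn_integral_C_Suc[of f t] by simp
  also have "\<dots> = (\<integral>\<^sup>+\<omega>. (\<integral>\<^sup>+y. (\<integral>\<^sup>+a. f (y, a) \<partial>\<pi> t (\<omega>, y)) \<partial>state_kernel t \<omega>) \<partial>C 0 t (\<lambda>_. undefined))"
    by (intro nn_integral_cong nn_integral_mdp_kernel) (simp_all add: space_C[OF u])
  finally show ?thesis .
qed

lemma space_state_kernel:
  assumes "\<omega> \<in> space (C 0 t (\<lambda>_. undefined))"
  shows "\<omega> \<in> space (PiM {0..<t} (\<lambda>_. S \<Otimes>\<^sub>M A))" "space (state_kernel t \<omega>) = space S"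
proof -
  show \<omega>: "\<omega> \<in> space (PiM {0..<t} (\<lambda>_. S \<Otimes>\<^sub>M A))"
    using assms by (simp add: space_C space_PiM)
  show "space (state_kernel t \<omega>) = space S"
    using measurable_space[OF state_kernel_measurable \<omega>]
    by (auto simp: space_prob_algebra dest: sets_eq_imp_space_eq)
qed

lemma nn_integral_state:
  assumes [measurable]: "f \<in> borel_measurable S"
  shows "(\<integral>\<^sup>+\<omega>. f (fst (\<omega> t)) \<partial>law) =
    (\<integral>\<^sup>+\<omega>. (\<integral>\<^sup>+y. f y \<partial>state_kernel t \<omega>) \<partial>C 0 t (\<lambda>_. undefined))"
  by (subst nn_integral_state_action)
     (auto intro!: nn_integral_cong
       simp: space_state_kernel prob_space.emeasure_space_1[OF prob_space_policy])

lemma nn_integral_state_0: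
  assumes [measurable]: "f \<in> borel_measurable S"
  shows "(\<integral>\<^sup>+\<omega>. f (fst (\<omega> 0)) \<partial>law) = f x"
  using x by (subst nn_integral_state)
    (simp_all add: state_kernel_def nn_integral_return space_PiM sets_PiM_empty)

lemma nn_integral_transition_measurable:
  assumes "f \<in> borel_measurable S"
  shows "(\<lambda>z. \<integral>\<^sup>+y. f y \<partial>q z) \<in> borel_measurable (S \<Otimes>\<^sub>M A)"
  using measurable_prob_algebraD[OF q] assms
  by (auto intro!: measurable_compose[OF _ nn_integral_measurable_subprob_algebra])

text \<open>\<open>state_kernel (Suc t)\<close> sees only the last state-action pair, even when the
  policy uses the whole history. This is why one-step inequalities suffice to bound the cost of
  arbitrary policies.\<close>

lemma nn_integral_state_Suc:
  assumes [measurable]: "f \<in> borel_measurable S"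
  shows "(\<integral>\<^sup>+\<omega>. f (fst (\<omega> (Suc t))) \<partial>law) = (\<integral>\<^sup>+\<omega>. (\<integral>\<^sup>+y. f y \<partial>q (\<omega> t)) \<partial>law)"
proof -
  have "(\<lambda>z. \<integral>\<^sup>+y. f y \<partial>q z) \<in> borel_measurable (S \<Otimes>\<^sub>M A)"
    by (rule nn_integral_transition_measurable) fact
  from nn_integral_lim_component[OF this] show ?thesis
    by (subst nn_integral_state) (simp_all add: mdp_law_def state_kernel_def)
qed

lemma space_lawD: "\<omega> \<in> space law \<Longrightarrow> fst (\<omega> t) \<in> space S \<and> snd (\<omega> t) \<in> space A"
  using sets_eq_imp_space_eq[OF sets_law] 
  by (auto simp: space_PiM space_pair_measure PiE_iff mem_Times_iff)

lemma emeasure_space_law: "emeasure law (space law) = 1"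
  using nn_integral_state_0[of "\<lambda>_. 1"] by simp

lemma discounted_cost_eq:
  assumes [measurable]: "c \<in> borel_measurable (S \<Otimes>\<^sub>M A)" and "0 \<le> \<alpha>"
  shows "discounted_cost S A q c \<alpha> \<pi> x =
    (\<Sum>t. ennreal \<alpha> ^ t * (\<integral>\<^sup>+\<omega>. ennreal (c (\<omega> t)) \<partial>law))"
proof -
  have "discounted_cost S A q c \<alpha> \<pi> x = (\<Sum>t. \<integral>\<^sup>+\<omega>. ennreal (\<alpha> ^ t * c (\<omega> t)) \<partial>law)"
    unfolding discounted_cost_def by (rule nn_integral_suminf) measurable
  also have "\<dots> = (\<Sum>t. ennreal \<alpha> ^ t * (\<integral>\<^sup>+\<omega>. ennreal (c (\<omega> t)) \<partial>law))"
    using \<open>0 \<le> \<alpha>\<close> by (simp add: ennreal_mult' nn_integral_cmult ennreal_power)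
  finally show ?thesis .
qed

text \<open>Lower bound for an arbitrary policy. The index of \<open>f\<close> counts the remaining
  periods, and the one-step inequality is unrolled along the trajectory until the terminal function
  \<open>f 0\<close> is reached.\<close>

lemma cost_to_go_le:
  assumes [measurable]: "c \<in> borel_measurable (S \<Otimes>\<^sub>M A)" "\<And>n. f n \<in> borel_measurable S"
    and step: "\<And>n y a. y \<in> space S \<Longrightarrow> a \<in> space A \<Longrightarrow>
      f (Suc n) y \<le> ennreal (c (y, a)) + ennreal \<alpha> * (\<integral>\<^sup>+y'. f n y' \<partial>q (y, a))"
  shows "f n x \<le> (\<Sum>t<n. ennreal \<alpha> ^ t * (\<integral>\<^sup>+\<omega>. ennreal (c (\<omega> t)) \<partial>law)) +
    ennreal \<alpha> ^ n * (\<integral>\<^sup>+\<omega>. f 0 (fst (\<omega> n)) \<partial>law)"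
proof -
  have one_step: "(\<integral>\<^sup>+\<omega>. f (Suc j) (fst (\<omega> k)) \<partial>law) \<le>
      (\<integral>\<^sup>+\<omega>. ennreal (c (\<omega> k)) \<partial>law) + ennreal \<alpha> * (\<integral>\<^sup>+\<omega>. f j (fst (\<omega> (Suc k))) \<partial>law)" for j k
  proof -
    have [measurable]: "(\<lambda>z. \<integral>\<^sup>+y. f j y \<partial>q z) \<in> borel_measurable (S \<Otimes>\<^sub>M A)"
      by (rule nn_integral_transition_measurable) measurable
    have "(\<integral>\<^sup>+\<omega>. f (Suc j) (fst (\<omega> k)) \<partial>law) \<le>
        (\<integral>\<^sup>+\<omega>. ennreal (c (\<omega> k)) + ennreal \<alpha> * (\<integral>\<^sup>+y. f j y \<partial>q (\<omega> k)) \<partial>law)"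
      using step[of "fst (\<omega> k)" "snd (\<omega> k)" j for \<omega>] space_lawD[of _ k]
      by (intro nn_integral_mono) auto
    also have "\<dots> = (\<integral>\<^sup>+\<omega>. ennreal (c (\<omega> k)) \<partial>law) + ennreal \<alpha> * (\<integral>\<^sup>+\<omega>. f j (fst (\<omega> (Suc k))) \<partial>law)"
      by (simp add: nn_integral_add nn_integral_cmult nn_integral_state_Suc)
    finally show ?thesis .
  qed
  \<comment> \<open>The horizon \<open>n\<close> stays fixed and the induction runs over the elapsed
    time \<open>k\<close>, since the locale fixes the initial state; an induction over
    \<open>n\<close> would have to restart the trajectory at a random state.\<close>
  have "f n x \<le> (\<Sum>t<k. ennreal \<alpha> ^ t * (\<integral>\<^sup>+\<omega>. ennreal (c (\<omega> t)) \<partial>law)) +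
      ennreal \<alpha> ^ k * (\<integral>\<^sup>+\<omega>. f (n - k) (fst (\<omega> k)) \<partial>law)" if "k \<le> n" for k
    using that
  proof (induction k)
    case 0
    then show ?case by (simp add: nn_integral_state_0)
  next
    case (Suc k)
    have "f n x \<le> (\<Sum>t<k. ennreal \<alpha> ^ t * (\<integral>\<^sup>+\<omega>. ennreal (c (\<omega> t)) \<partial>law)) +
        ennreal \<alpha> ^ k * (\<integral>\<^sup>+\<omega>. f (Suc (n - Suc k)) (fst (\<omega> k)) \<partial>law)"
      using Suc by (simp add: Suc_diff_Suc)
    also have "\<dots> \<le> (\<Sum>t<k. ennreal \<alpha> ^ t * (\<integral>\<^sup>+\<omega>. ennreal (c (\<omega> t)) \<partial>law)) +
        ennreal \<alpha> ^ k * ((\<integral>\<^sup>+\<omega>. ennreal (c (\<omega> k)) \<partial>law) +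
          ennreal \<alpha> * (\<integral>\<^sup>+\<omega>. f (n - Suc k) (fst (\<omega> (Suc k))) \<partial>law))"
      by (intro add_left_mono mult_left_mono one_step) auto
    finally show ?case
      by (simp add: distrib_left algebra_simps)
  qed
  from this[of n] show ?thesis by simp
qed

text \<open>Linear growth of the terminal term in \<open>cost_to_go_le\<close>; after discounting by
  \<alpha>^n it vanishes in the limit.\<close>

lemma nn_integral_state_drift_le:
  assumes [measurable]: "f \<in> borel_measurable S"
    and drift: "\<And>y a. y \<in> space S \<Longrightarrow> a \<in> space A \<Longrightarrow> (\<integral>\<^sup>+y'. f y' \<partial>q (y, a)) \<le> f y + d"
  shows "(\<integral>\<^sup>+\<omega>. f (fst (\<omega> n)) \<partial>law) \<le> f x + of_nat n * d"
proof (induction n)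
  case 0
  then show ?case by (simp add: nn_integral_state_0)
next
  case (Suc n)
  have "(\<integral>\<^sup>+\<omega>. f (fst (\<omega> (Suc n))) \<partial>law) \<le> (\<integral>\<^sup>+\<omega>. f (fst (\<omega> n)) + d \<partial>law)"
    unfolding nn_integral_state_Suc[OF assms(1)]
    using drift[of "fst (\<omega> n)" "snd (\<omega> n)" for \<omega>] space_lawD[of _ n]
    by (intro nn_integral_mono) auto
  also have "\<dots> = (\<integral>\<^sup>+\<omega>. f (fst (\<omega> n)) \<partial>law) + d"
    by (simp add: nn_integral_add emeasure_space_law)
  also have "\<dots> \<le> f x + of_nat (Suc n) * d"
    using add_right_mono[OF Suc, of d] by (simp add: distrib_right algebra_simps)
  finally show ?case .
qed

end

section \<open>Upper bounds from stationary policies\<close>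

lemma stationary_policy:
  assumes \<phi>[measurable]: "\<phi> \<in> S \<rightarrow>\<^sub>M A"
  shows "(\<lambda>t (\<omega>, y). return A (\<phi> y)) \<in> policies S A"
  unfolding policies_def split_beta'
  by (auto intro!: measurable_compose[OF _ measurable_return_prob_space])

text \<open>Under the stationary policy, the cost of the first \<open>n\<close> periods plus the
  discounted expectation of \<open>W\<close> at time \<open>n\<close> stays below
  \<open>W x\<close>, by induction on \<open>n\<close>. The second term is nonnegative and is
  dropped before \<open>n\<close> tends to infinity.\<close>

lemma discounted_value_le_supersolution:
  assumes q: "q \<in> S \<Otimes>\<^sub>M A \<rightarrow>\<^sub>M prob_algebra S" and x: "x \<in> space S"
    and c[measurable]: "c \<in> borel_measurable (S \<Otimes>\<^sub>M A)" and "0 \<le> \<alpha>"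
    and \<phi>[measurable]: "\<phi> \<in> S \<rightarrow>\<^sub>M A" and W[measurable]: "W \<in> borel_measurable S"
    and super: "\<And>y. y \<in> space S \<Longrightarrow>
      ennreal (c (y, \<phi> y)) + ennreal \<alpha> * (\<integral>\<^sup>+y'. W y' \<partial>q (y, \<phi> y)) \<le> W y"
  shows "discounted_value S A q c \<alpha> x \<le> W x"
proof -
  define \<pi> where "\<pi> = (\<lambda>t :: nat. \<lambda>(\<omega> :: nat \<Rightarrow> 'a \<times> 'b, y). return A (\<phi> y))"
  have \<pi>: "\<pi> \<in> policies S A"
    unfolding \<pi>_def by (rule stationary_policy) fact
  interpret mdp_trajectory S A q \<pi> x
    using \<pi> q x by unfold_locales
  have action: "(\<integral>\<^sup>+\<omega>. f (\<omega> t) \<partial>law) = (\<integral>\<^sup>+\<omega>. f (fst (\<omega> t), \<phi> (fst (\<omega> t))) \<partial>law)"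
    if [measurable]: "f \<in> borel_measurable (S \<Otimes>\<^sub>M A)" for f t
    by (subst nn_integral_state_action, measurable, subst nn_integral_state[of "\<lambda>y. f (y, \<phi> y)"], measurable)
       (auto intro!: nn_integral_cong nn_integral_return simp: space_state_kernel \<pi>_def measurable_space[OF \<phi>])
  let ?c = "\<lambda>t. ennreal \<alpha> ^ t * (\<integral>\<^sup>+\<omega>. ennreal (c (\<omega> t)) \<partial>law)"
  have "(\<Sum>t<n. ?c t) + ennreal \<alpha> ^ n * (\<integral>\<^sup>+\<omega>. W (fst (\<omega> n)) \<partial>law) \<le> W x" for n
  proof (induction n)
    case 0
    then show ?case by (simp add: nn_integral_state_0)
  next
    case (Suc n)
    have [measurable]: "(\<lambda>z. \<integral>\<^sup>+y. W y \<partial>q z) \<in> borel_measurable (S \<Otimes>\<^sub>M A)"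
      by (rule nn_integral_transition_measurable) measurable
    have "(\<integral>\<^sup>+\<omega>. ennreal (c (\<omega> n)) \<partial>law) + ennreal \<alpha> * (\<integral>\<^sup>+\<omega>. W (fst (\<omega> (Suc n))) \<partial>law)
        = (\<integral>\<^sup>+\<omega>. ennreal (c (\<omega> n)) + ennreal \<alpha> * (\<integral>\<^sup>+y. W y \<partial>q (\<omega> n)) \<partial>law)"
      by (simp add: nn_integral_add nn_integral_cmult nn_integral_state_Suc)
    also have "\<dots> \<le> (\<integral>\<^sup>+\<omega>. W (fst (\<omega> n)) \<partial>law)"
      by (subst action) (auto intro!: nn_integral_mono super simp: space_lawD)
    finally have "ennreal \<alpha> ^ n * ((\<integral>\<^sup>+\<omega>. ennreal (c (\<omega> n)) \<partial>law) +
        ennreal \<alpha> * (\<integral>\<^sup>+\<omega>. W (fst (\<omega> (Suc n))) \<partial>law)) \<le>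
        ennreal \<alpha> ^ n * (\<integral>\<^sup>+\<omega>. W (fst (\<omega> n)) \<partial>law)"
      by (rule mult_left_mono) simp
    then have "(\<Sum>t<Suc n. ?c t) + ennreal \<alpha> ^ Suc n * (\<integral>\<^sup>+\<omega>. W (fst (\<omega> (Suc n))) \<partial>law) \<le>
        (\<Sum>t<n. ?c t) + ennreal \<alpha> ^ n * (\<integral>\<^sup>+\<omega>. W (fst (\<omega> n)) \<partial>law)"
      by (simp add: distrib_left ac_simps add_left_mono)
    with Suc show ?case by (rule order_trans[rotated])
  qed
  then have "(\<Sum>t<n. ?c t) \<le> W x" for n
    using order_trans[OF le_iff_add[THEN iffD2, OF exI, OF refl]] by blast
  then have "(\<Sum>t. ?c t) \<le> W x"
    by (simp add: suminf_eq_SUP SUP_le_iff)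
  then have "discounted_cost S A q c \<alpha> \<pi> x \<le> W x"
    by (simp add: discounted_cost_eq \<open>0 \<le> \<alpha>\<close>)
  then show ?thesis
    unfolding discounted_value_def using \<pi> by (rule INF_lower2[rotated])
qed

section \<open>Value iteration with a fixed ordering cost\<close>

text \<open>The problem left after the unit cost is removed and the holding cost \<open>F\<close> is
  shifted to vanish at its minimiser \<open>S\<close>. Left of \<open>b\<close> the excess holding
  cost pays for an order; from \<open>R0\<close> on it outweighs the setup cost that a larger stock
  might save later, which confines order-up-to levels to \<open>[S, R0]\<close>.\<close>

locale setup_cost_problem = prob_space M for M :: "'w measure" +
  fixes d :: "'w \<Rightarrow> real" and F :: "real \<Rightarrow> real" and \<alpha> K b S R0 :: real
  assumes d_measurable [measurable]: "d \<in> borel_measurable M"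
    and d_nonneg: "\<And>\<omega>. \<omega> \<in> space M \<Longrightarrow> 0 \<le> d \<omega>"
    and \<alpha>: "0 \<le> \<alpha>" "\<alpha> < 1"
    and K_pos: "0 < K"
    and b_less_S: "b < S" and S_le_R0: "S \<le> R0"
    and F_cont: "continuous_on UNIV F"
    and F_nonneg: "\<And>x. 0 \<le> F x"
    and F_S: "F S = 0"
    and F_antimono: "\<And>x y. x \<le> y \<Longrightarrow> y \<le> S \<Longrightarrow> F y \<le> F x"
    and F_mono: "\<And>x y. S \<le> x \<Longrightarrow> x \<le> y \<Longrightarrow> F x \<le> F y"
    and F_left: "\<And>x. x \<le> b \<Longrightarrow> K \<le> F x"
    and F_right: "\<And>x. R0 \<le> x \<Longrightarrow> K \<le> F x"
begin

section \<open>The Bellman operator, with \<open>J f y\<close> the cost of holding stock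
  \<open>y\<close> after ordering\<close>

definition J :: "(real \<Rightarrow> real) \<Rightarrow> real \<Rightarrow> real" where
  "J f y = F y + \<alpha> * expectation (\<lambda>\<omega>. f (y - d \<omega>))"

text \<open>The interval is compact, so the infimum is attained; \<open>min_J_attained\<close> shows
  that it is the minimum over the whole line.\<close>

definition min_J :: "(real \<Rightarrow> real) \<Rightarrow> real" where
  "min_J f = Inf (J f ` {S..R0})"

text \<open>The optimisation over orders is already carried out: from \<open>S\<close> on ordering
  does not pay (\<open>J_setup_le\<close>), and below \<open>S\<close> the only candidate target is
  a level attaining \<open>min_J f\<close>.\<close>

definition T :: "(real \<Rightarrow> real) \<Rightarrow> real \<Rightarrow> real" where
  "T f x = (if S \<le> x then J f x else min (J f x) (K + min_J f))"

text \<open>The last condition expresses that ordering up from \<open>x\<close> to \<open>y\<close> is always possible, at cost \<open>K\<close>.\<close>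

definition regular :: "(real \<Rightarrow> real) \<Rightarrow> bool" where
  "regular f \<longleftrightarrow> continuous_on UNIV f \<and> (\<forall>x. 0 \<le> f x) \<and> (\<forall>x y. x \<le> y \<longrightarrow> y \<le> S \<longrightarrow> f y \<le> f x) \<and>
     (\<forall>x\<le>b. f x = f b) \<and> (\<forall>x y. x \<le> y \<longrightarrow> f x \<le> K + f y)"

lemma regularD:
  assumes "regular f"
  shows "continuous_on UNIV f" "\<And>x. 0 \<le> f x" "\<And>x y. x \<le> y \<Longrightarrow> y \<le> S \<Longrightarrow> f y \<le> f x"
    "\<And>x. x \<le> b \<Longrightarrow> f x = f b" "\<And>x y. x \<le> y \<Longrightarrow> f x \<le> K + f y"
  using assms unfolding regular_def by blast+

lemma regular_zero: "regular (\<lambda>_. 0)"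
  using K_pos by (auto simp: regular_def)

lemma regular_borel [measurable_dest]: "regular f \<Longrightarrow> f \<in> borel_measurable borel"
  by (rule borel_measurable_continuous_onI) (rule regularD)

text \<open>Compactness handles \<open>[b, max b R]\<close>, and \<open>f\<close> is constant
  further left. Bounds on half-lines are what is needed: \<open>f\<close> may grow to the right, but
  demand only moves the state to the left.\<close>

lemma regular_bounded:
  assumes f: "regular f"
  obtains B where "\<And>x. x \<le> R \<Longrightarrow> f x \<le> B"
proof -
  have 1: "continuous_on {b..max b R} f"
    by (rule continuous_on_subset[OF regularD(1)[OF f]]) simp
  have "compact (f ` {b..max b R})"
    by (rule compact_continuous_image[OF 1 compact_Icc])
  then have "bdd_above (f ` {b..max b R})"
    by (rule bounded_imp_bdd_above[OF compact_imp_bounded])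
  then obtain B where B0: "\<forall>z\<in>f ` {b..max b R}. z \<le> B"
    unfolding bdd_above_def by (rule exE)
  have "f x \<le> B" if "x \<le> R" for x
  proof -
    have "max b x \<in> {b..max b R}"
      using \<open>x \<le> R\<close> by auto
    then have "f (max b x) \<le> B"
      using B0 by (rule bspec[OF _ imageI, rotated])
    moreover have "f (max b x) = f x"
      using regularD(4)[OF f, of x] by (cases "x \<le> b") (simp_all add: max_def)
    ultimately show ?thesis by simp
  qed
  then show ?thesis by (rule that)
qed

lemma regular_integrable:
  assumes f: "regular f"
  shows "integrable M (\<lambda>\<omega>. f (y - d \<omega>))"
proof -
  note [measurable] = regular_borel[OF f]
  obtain B where B: "\<And>x. x \<le> y \<Longrightarrow> f x \<le> B"
    using regular_bounded[OF f] by blast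
  show ?thesis
  proof (rule integrable_const_bound[where B = B])
    show "AE \<omega> in M. norm (f (y - d \<omega>)) \<le> B"
      using d_nonneg by (intro AE_I2) (auto simp: regularD(2)[OF f] intro!: B)
  qed measurable
qed

text \<open>Dominated convergence: a convergent sequence of levels stays below some
  \<open>R\<close>, and \<open>f\<close> is bounded on that half-line.\<close>

lemma J_cont:
  assumes f: "regular f"
  shows "continuous_on UNIV (J f)"
proof -
  note [measurable] = regular_borel[OF f]
  have "isCont (\<lambda>y. expectation (\<lambda>\<omega>. f (y - d \<omega>))) y" for y
  proof (rule continuous_at_sequentiallyI)
    fix u assume u: "u \<longlonglongrightarrow> y"
    then obtain R where R: "\<And>n. u n \<le> R"
      using Bseq_bdd_above[OF convergent_imp_Bseq[OF convergentI]] by (force simp: bdd_above_def)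
    obtain B where B: "\<And>x. x \<le> R \<Longrightarrow> f x \<le> B"
      using regular_bounded[OF f] by blast
    show "(\<lambda>n. expectation (\<lambda>\<omega>. f (u n - d \<omega>))) \<longlonglongrightarrow> expectation (\<lambda>\<omega>. f (y - d \<omega>))"
    proof (rule integral_dominated_convergence[where w = "\<lambda>_. B"])
      show "AE \<omega> in M. (\<lambda>n. f (u n - d \<omega>)) \<longlonglongrightarrow> f (y - d \<omega>)"
        using regularD(1)[OF f] u
        by (intro AE_I2 isCont_tendsto_compose[of _ f] tendsto_intros) (auto simp: continuous_on_eq_continuous_at)
      show "AE \<omega> in M. norm (f (u n - d \<omega>)) \<le> B" for n
        using d_nonneg R[of n] by (intro AE_I2) (auto simp: regularD(2)[OF f] intro!: B intro: order_trans[of _ "u n"])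
    qed auto
  qed
  then show ?thesis
    unfolding J_def using F_cont by (intro continuous_intros) (auto simp: continuous_on_eq_continuous_at)
qed

lemma J_nonneg: "regular f \<Longrightarrow> 0 \<le> J f y"
  unfolding J_def using F_nonneg \<alpha> by (intro add_nonneg_nonneg mult_nonneg_nonneg Bochner_Integration.integral_nonneg) (simp_all add: regularD(2))

lemma expectation_regular_le:
  assumes "regular f" "\<And>\<omega>. \<omega> \<in> space M \<Longrightarrow> f (x - d \<omega>) \<le> C + f (y - d \<omega>)"
  shows "expectation (\<lambda>\<omega>. f (x - d \<omega>)) \<le> C + expectation (\<lambda>\<omega>. f (y - d \<omega>))"
proof -
  have "expectation (\<lambda>\<omega>. f (x - d \<omega>)) \<le> expectation (\<lambda>\<omega>. C + f (y - d \<omega>))"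
    using assms by (intro integral_mono) (auto intro: regular_integrable)
  also have "\<dots> = C + expectation (\<lambda>\<omega>. f (y - d \<omega>))"
    using regular_integrable[OF assms(1)] by (simp add: prob_space)
  finally show ?thesis .
qed

lemma expectation_left_le:
  assumes f: "regular f" and "x \<le> y" "y \<le> S"
  shows "\<alpha> * expectation (\<lambda>\<omega>. f (y - d \<omega>)) \<le> \<alpha> * expectation (\<lambda>\<omega>. f (x - d \<omega>))"
proof (rule mult_left_mono)
  have "f (y - d \<omega>) \<le> 0 + f (x - d \<omega>)" if "\<omega> \<in> space M" for \<omega>
    using regularD(3)[OF f, of "x - d \<omega>" "y - d \<omega>"] d_nonneg[OF that] assms(2,3) by simp
  from expectation_regular_le[OF f this]
  show "expectation (\<lambda>\<omega>. f (y - d \<omega>)) \<le> expectation (\<lambda>\<omega>. f (x - d \<omega>))" by simp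
qed (use \<alpha> in simp)

lemma expectation_setup_le:
  assumes f: "regular f" and "x \<le> y"
  shows "\<alpha> * expectation (\<lambda>\<omega>. f (x - d \<omega>)) \<le> K + \<alpha> * expectation (\<lambda>\<omega>. f (y - d \<omega>))"
proof -
  have "expectation (\<lambda>\<omega>. f (x - d \<omega>)) \<le> K + expectation (\<lambda>\<omega>. f (y - d \<omega>))"
    using regularD(5)[OF f] assms(2) by (intro expectation_regular_le[OF f]) auto
  then have "\<alpha> * expectation (\<lambda>\<omega>. f (x - d \<omega>)) \<le> \<alpha> * (K + expectation (\<lambda>\<omega>. f (y - d \<omega>)))"
    using \<alpha> by (intro mult_left_mono)
  moreover have "\<alpha> * K \<le> K" using \<alpha> K_pos by simp
  ultimately show ?thesis by (simp add: distrib_left)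
qed

lemma J_antimono: "regular f \<Longrightarrow> x \<le> y \<Longrightarrow> y \<le> S \<Longrightarrow> J f y \<le> J f x"
  unfolding J_def by (intro add_mono F_antimono expectation_left_le)

text \<open>Right of \<open>S\<close> a higher level has no smaller holding cost, and the
  continuation can save at most \<alpha> times \<open>K\<close>. Hence no order is worthwhile
  there.\<close>

lemma J_setup_le: "regular f \<Longrightarrow> S \<le> x \<Longrightarrow> x \<le> y \<Longrightarrow> J f x \<le> K + J f y"
  unfolding J_def using F_mono[of x y] expectation_setup_le[of f x y] by simp

text \<open>Left of \<open>S\<close> the function \<open>J f\<close> decreases. Right of
  \<open>R0\<close> the holding cost is at least \<open>K\<close>, which outweighs what the
  continuation saves compared with \<open>S\<close>.\<close>

lemma min_J_attained:
  assumes f: "regular f"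
  obtains y where "S \<le> y" "y \<le> R0" "J f y = min_J f" "\<And>z. min_J f \<le> J f z"
proof -
  have "\<exists>y\<in>{S..R0}. \<forall>z\<in>{S..R0}. J f y \<le> J f z"
    using S_le_R0 by (intro continuous_attains_inf continuous_on_subset[OF J_cont[OF f]]) auto
  then obtain y where y: "S \<le> y" "y \<le> R0" "\<And>z. S \<le> z \<Longrightarrow> z \<le> R0 \<Longrightarrow> J f y \<le> J f z"
    by auto
  have eq: "J f y = min_J f"
    unfolding min_J_def by (rule cInf_eq_minimum[symmetric]) (use y in auto)
  have "J f y \<le> J f z" for z
  proof -
    consider "z \<le> S" | "S \<le> z" "z \<le> R0" | "R0 \<le> z" by linarith
    then show ?thesis
    proof cases
      case 1
      then show ?thesis using J_antimono[OF f, of z S] y(3)[of S] S_le_R0 by simp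
    next
      case 2
      then show ?thesis using y by simp
    next
      case 3
      then have "J f S \<le> J f z"
        unfolding J_def using expectation_setup_le[OF f, of S z] S_le_R0 F_S F_right[of z] by simp
      then show ?thesis using y(3)[of S] S_le_R0 by simp
    qed
  qed
  with y eq show ?thesis by (intro that[of y]) auto
qed

lemma min_J_le: "regular f \<Longrightarrow> min_J f \<le> J f z"
  by (metis min_J_attained)

text \<open>This makes the two branches of \<open>T\<close> agree at \<open>S\<close>, which gives
  \<open>T_left\<close> and the continuity of \<open>T f\<close>.\<close>

lemma J_S_le: assumes "regular f" shows "J f S \<le> K + min_J f"
  by (metis min_J_attained[OF assms] J_setup_le[OF assms order_refl])

lemma T_le_J: "T f x \<le> J f x"
  by (simp add: T_def)

lemma min_J_le_T: "regular f \<Longrightarrow> min_J f \<le> T f x"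
  using min_J_le[of f x] K_pos by (auto simp: T_def)

lemma T_left: "regular f \<Longrightarrow> x \<le> S \<Longrightarrow> T f x = min (J f x) (K + min_J f)"
  using J_S_le[of f] by (auto simp: T_def)

text \<open>Together with \<open>T_le_J\<close> this covers every admissible action, so
  \<open>T\<close> is a lower bound for the one-step problem although its definition considers a
  single target level.\<close>

lemma T_setup_le:
  assumes "regular f" "x < y"
  shows "T f x \<le> K + J f y"
  using J_setup_le[of f x y] min_J_le[of f y] assms by (auto simp: T_def)

text \<open>Staying at \<open>x\<close> costs at least \<open>K\<close> more in holding than being
  at \<open>S\<close>, and its continuation is no cheaper, so ordering is at least as good. The
  right-hand side is free of \<open>x\<close>, hence the constancy below \<open>b\<close>.\<close>

lemma T_below_b:
  assumes f: "regular f" and "x \<le> b"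
  shows "T f x = K + min_J f"
proof -
  have "K + J f S \<le> J f x"
    unfolding J_def using F_S F_left[of x] expectation_left_le[OF f, of x S] b_less_S assms by simp
  then show ?thesis
    using min_J_le[OF f, of S] T_left[OF f, of x] b_less_S assms by simp
qed

lemma T_regular:
  assumes f: "regular f"
  shows "regular (T f)"
  unfolding regular_def
proof (intro conjI allI impI)
  have "continuous_on ({S..} \<union> {..S}) (\<lambda>x. if S \<le> x then J f x else min (J f x) (K + min_J f))"
    using J_S_le[OF f]
    by (intro continuous_on_cases continuous_intros continuous_on_subset[OF J_cont[OF f]]) auto
  moreover have "{S..} \<union> {..S} = UNIV" by auto
  ultimately show "continuous_on UNIV (T f)"
    unfolding T_def[abs_def] by simp
  show "0 \<le> T f x" for x
    using min_J_le_T[OF f, of x] J_nonneg[OF f] by (metis min_J_attained[OF f] order_trans)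
  show "T f y \<le> T f x" if "x \<le> y" "y \<le> S" for x y
    using J_antimono[OF f that] that by (auto simp: T_left[OF f])
  show "T f x = T f b" if "x \<le> b" for x
    using that by (simp add: T_below_b[OF f])
  show "T f x \<le> K + T f y" if "x \<le> y" for x y
    using that min_J_le_T[OF f, of y] J_setup_le[OF f, of x y] by (auto simp: T_def)
qed

lemma J_dist_le:
  assumes f: "regular f" and g: "regular g" and C: "\<And>x. x \<le> y \<Longrightarrow> \<bar>f x - g x\<bar> \<le> C"
  shows "\<bar>J f y - J g y\<bar> \<le> \<alpha> * C"
proof -
  have "\<bar>expectation (\<lambda>\<omega>. f (y - d \<omega>)) - expectation (\<lambda>\<omega>. g (y - d \<omega>))\<bar> =
      \<bar>expectation (\<lambda>\<omega>. f (y - d \<omega>) - g (y - d \<omega>))\<bar>"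
    using regular_integrable[OF f] regular_integrable[OF g] by simp
  also have "\<dots> \<le> expectation (\<lambda>\<omega>. \<bar>f (y - d \<omega>) - g (y - d \<omega>)\<bar>)"
    by (rule integral_abs_bound)
  also have "\<dots> \<le> expectation (\<lambda>_. C)"
    using regular_integrable[OF f] regular_integrable[OF g] d_nonneg
    by (intro integral_mono) (auto intro!: C)
  also have "\<dots> = C" by (simp add: prob_space)
  finally show ?thesis
    using \<alpha> by (simp add: J_def right_diff_distrib[symmetric] abs_mult mult_left_mono)
qed

text \<open>Contraction on a half-line, since regular functions need not be bounded on the whole
  line. The half-line is invariant: demand is nonnegative and order-up-to levels are at most
  \<open>R0\<close>.\<close>

lemma T_dist_le:
  assumes f: "regular f" and g: "regular g" and C: "\<And>x. x \<le> R \<Longrightarrow> \<bar>f x - g x\<bar> \<le> C"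
    and "R0 \<le> R" "x \<le> R"
  shows "\<bar>T f x - T g x\<bar> \<le> \<alpha> * C"
proof -
  have J: "\<bar>J f y - J g y\<bar> \<le> \<alpha> * C" if "y \<le> R" for y
    using that by (intro J_dist_le[OF f g] C) simp
  obtain y where y: "y \<le> R0" "J f y = min_J f" using min_J_attained[OF f] by metis
  obtain z where z: "z \<le> R0" "J g z = min_J g" using min_J_attained[OF g] by metis
  have "\<bar>min_J f - min_J g\<bar> \<le> \<alpha> * C"
    using J[of y] J[of z] y z min_J_le[OF f, of z] min_J_le[OF g, of y] \<open>R0 \<le> R\<close> by linarith
  with J[OF \<open>x \<le> R\<close>] show ?thesis
    by (auto simp: T_def min_def)
qed

section \<open>Convergence of value iteration to a fixed point\<close>

definition iter :: "nat \<Rightarrow> real \<Rightarrow> real" where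
  "iter n = (T ^^ n) (\<lambda>_. 0)"

lemma iter_simps: "iter 0 = (\<lambda>_. 0)" "iter (Suc n) = T (iter n)"
  by (simp_all add: iter_def)

lemma iter_regular: "regular (iter n)"
  by (induction n) (simp_all add: iter_simps regular_zero T_regular)

text \<open>The first increment is bounded on the half-line, each application of \<open>T\<close>
  shrinks it by \<alpha>, and the increments sum to a geometric tail.\<close>

lemma iter_convergence:
  assumes "R0 \<le> R"
  obtains C where "0 \<le> C" "\<And>m n x. n \<le> m \<Longrightarrow> x \<le> R \<Longrightarrow> \<bar>iter m x - iter n x\<bar> \<le> C * \<alpha> ^ n"
proof -
  obtain B where B: "\<And>x. x \<le> R \<Longrightarrow> iter 1 x \<le> B"
    using regular_bounded[OF iter_regular] by blast
  have step: "\<bar>iter (Suc n) x - iter n x\<bar> \<le> B * \<alpha> ^ n" if "x \<le> R" for n x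
    using that
  proof (induction n arbitrary: x)
    case 0
    then show ?case using B[of x] regularD(2)[OF iter_regular, of 1 x] by (simp add: iter_simps)
  next
    case (Suc n)
    show ?case
      using T_dist_le[OF iter_regular iter_regular Suc.IH assms Suc.prems] by (simp add: iter_simps mult_ac)
  qed
  have "0 \<le> B" using step[of R 0] by simp
  have tele: "\<bar>iter (n + k) x - iter n x\<bar> \<le> B * \<alpha> ^ n * (\<Sum>i<k. \<alpha> ^ i)" if "x \<le> R" for n k x
  proof (induction k)
    case (Suc k)
    have "\<bar>iter (n + Suc k) x - iter n x\<bar> \<le> \<bar>iter (Suc (n + k)) x - iter (n + k) x\<bar> + \<bar>iter (n + k) x - iter n x\<bar>"
      by simp
    also have "\<dots> \<le> B * \<alpha> ^ (n + k) + B * \<alpha> ^ n * (\<Sum>i<k. \<alpha> ^ i)"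
      by (intro add_mono step that Suc)
    finally show ?case by (simp add: power_add distrib_left ac_simps)
  qed simp
  have geo: "(\<Sum>i<k. \<alpha> ^ i) \<le> 1 / (1 - \<alpha>)" for k
    using \<alpha> by (subst sum_gp_strict) (auto simp: divide_right_mono)
  show ?thesis
  proof (rule that[of "B / (1 - \<alpha>)"])
    show "0 \<le> B / (1 - \<alpha>)" using \<open>0 \<le> B\<close> \<alpha> by simp
    fix m n :: nat and x assume "n \<le> m" "x \<le> R"
    have "\<bar>iter m x - iter n x\<bar> \<le> B * \<alpha> ^ n * (\<Sum>i<m - n. \<alpha> ^ i)"
      using tele[OF \<open>x \<le> R\<close>, of n "m - n"] \<open>n \<le> m\<close> by simp
    also have "\<dots> \<le> B * \<alpha> ^ n * (1 / (1 - \<alpha>))"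
      using \<open>0 \<le> B\<close> \<alpha> by (intro mult_left_mono geo) auto
    finally show "\<bar>iter m x - iter n x\<bar> \<le> B / (1 - \<alpha>) * \<alpha> ^ n" by (simp add: mult_ac)
  qed
qed

definition U :: "real \<Rightarrow> real" where
  "U x = lim (\<lambda>n. iter n x)"

lemma iter_tendsto: "(\<lambda>n. iter n x) \<longlonglongrightarrow> U x"
proof -
  obtain C where C: "0 \<le> C" "\<And>m n y. n \<le> m \<Longrightarrow> y \<le> max R0 x \<Longrightarrow> \<bar>iter m y - iter n y\<bar> \<le> C * \<alpha> ^ n"
    using iter_convergence[of "max R0 x"] by auto
  have lim: "(\<lambda>n. C * \<alpha> ^ n) \<longlonglongrightarrow> C * 0"
    using \<alpha> by (intro tendsto_intros LIMSEQ_realpow_zero) auto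
  have "Cauchy (\<lambda>n. iter n x)"
  proof (rule CauchyI')
    fix e :: real assume "0 < e"
    with lim have "\<forall>\<^sub>F n in sequentially. C * \<alpha> ^ n < e"
      by (intro order_tendstoD(2)[OF lim]) simp
    then obtain N where N: "\<And>n. N \<le> n \<Longrightarrow> C * \<alpha> ^ n < e" by (auto simp: eventually_sequentially)
    have "dist (iter m x) (iter n x) < e" if "N \<le> m" "m < n" for m n
      using C(2)[of m n x] N[of m] that by (simp add: dist_real_def abs_minus_commute)
    then show "\<exists>N. \<forall>m\<ge>N. \<forall>n>m. dist (iter m x) (iter n x) < e" by blast
  qed
  then show ?thesis
    unfolding U_def by (simp add: Cauchy_convergent_iff convergent_LIMSEQ_iff)
qed

lemma U_dist_iter_le:
  assumes "R0 \<le> R"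
  obtains C where "0 \<le> C" "\<And>n x. x \<le> R \<Longrightarrow> \<bar>U x - iter n x\<bar> \<le> C * \<alpha> ^ n"
proof -
  obtain C where C: "0 \<le> C" "\<And>m n x. n \<le> m \<Longrightarrow> x \<le> R \<Longrightarrow> \<bar>iter m x - iter n x\<bar> \<le> C * \<alpha> ^ n"
    using iter_convergence[OF assms] by blast
  have "\<bar>U x - iter n x\<bar> \<le> C * \<alpha> ^ n" if "x \<le> R" for x n
    by (rule tendsto_upperbound[OF tendsto_rabs[OF tendsto_diff[OF iter_tendsto tendsto_const]]])
       (use C(2)[OF _ that] in \<open>auto simp: eventually_sequentially\<close>)
  with C(1) show ?thesis by (rule that)
qed

lemma U_regular: "regular U"
  unfolding regular_def
proof (intro conjI allI impI)
  show "continuous_on UNIV U"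
  proof -
    have "isCont U x" for x
    proof -
      define R where "R = max R0 (x + 1)"
      obtain C where C: "0 \<le> C" "\<And>n y. y \<le> R \<Longrightarrow> \<bar>U y - iter n y\<bar> \<le> C * \<alpha> ^ n"
        using U_dist_iter_le[of R] by (auto simp: R_def)
      \<comment> \<open>The half-line is open and contains \<open>x\<close>, so continuity on it
        yields continuity at \<open>x\<close>.\<close>
      have "uniform_limit {..<x + 1} iter U sequentially"
      proof (rule uniform_limitI)
        fix e :: real assume "0 < e"
        have lim: "(\<lambda>n. C * \<alpha> ^ n) \<longlonglongrightarrow> C * 0"
          using \<alpha> by (intro tendsto_intros LIMSEQ_realpow_zero) auto
        have "\<forall>\<^sub>F n in sequentially. C * \<alpha> ^ n < e"
          using \<open>0 < e\<close> by (intro order_tendstoD(2)[OF lim]) simp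
        then show "\<forall>\<^sub>F n in sequentially. \<forall>y\<in>{..<x + 1}. dist (iter n y) (U y) < e"
        proof eventually_elim
          case (elim n)
          have "dist (iter n y) (U y) < e" if "y < x + 1" for y
            using C(2)[of y n] elim that by (simp add: R_def dist_real_def abs_minus_commute le_max_iff_disj)
          then show ?case by simp
        qed
      qed
      then have "continuous_on {..<x + 1} U"
        by (rule uniform_limit_theorem[rotated])
           (auto intro!: always_eventually continuous_on_subset[OF regularD(1)[OF iter_regular]])
      then show ?thesis
        by (auto simp: continuous_on_eq_continuous_at)
    qed
    then show ?thesis by (simp add: continuous_on_eq_continuous_at)
  qed
  show "0 \<le> U x" for x
    by (rule LIMSEQ_le_const[OF iter_tendsto]) (use regularD(2)[OF iter_regular] in auto)
  show "U y \<le> U x" if "x \<le> y" "y \<le> S" for x y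
    by (rule LIMSEQ_le[OF iter_tendsto iter_tendsto]) (use regularD(3)[OF iter_regular that] in auto)
  show "U x = U b" if "x \<le> b" for x
    unfolding U_def using regularD(4)[OF iter_regular that] by simp
  show "U x \<le> K + U y" if "x \<le> y" for x y
    by (rule LIMSEQ_le[OF iter_tendsto tendsto_add[OF tendsto_const iter_tendsto]])
       (use regularD(5)[OF iter_regular that] in auto)
qed

text \<open>\<open>T (iter n)\<close> is the shifted sequence, which tends to \<open>U\<close>; by
  the contraction estimate it also tends to \<open>T U\<close>.\<close>

lemma T_U: "T U = U"
proof
  fix x
  obtain C where C: "0 \<le> C" "\<And>n y. y \<le> max R0 x \<Longrightarrow> \<bar>U y - iter n y\<bar> \<le> C * \<alpha> ^ n"
    using U_dist_iter_le[of "max R0 x"] by auto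
  have "(\<lambda>n. iter (Suc n) x - T U x) \<longlonglongrightarrow> 0"
  proof (rule Lim_null_comparison)
    have "\<bar>T U x - T (iter n) x\<bar> \<le> \<alpha> * (C * \<alpha> ^ n)" for n
      using C(2) by (intro T_dist_le[OF U_regular iter_regular, where R = "max R0 x"]) auto
    then show "\<forall>\<^sub>F n in sequentially. norm (iter (Suc n) x - T U x) \<le> \<alpha> * (C * \<alpha> ^ n)"
      by (simp add: iter_simps abs_minus_commute)
    have "(\<lambda>n. \<alpha> * (C * \<alpha> ^ n)) \<longlonglongrightarrow> \<alpha> * (C * 0)"
      using \<alpha> by (intro tendsto_intros LIMSEQ_realpow_zero) auto
    then show "(\<lambda>n. \<alpha> * (C * \<alpha> ^ n)) \<longlonglongrightarrow> 0" by simp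
  qed
  then have "(\<lambda>n. iter (Suc n) x) \<longlonglongrightarrow> T U x"
    by (rule LIM_zero_cancel)
  moreover have "(\<lambda>n. iter (Suc n) x) \<longlonglongrightarrow> U x"
    using iter_tendsto by (rule LIMSEQ_Suc)
  ultimately show "T U x = U x"
    by (rule LIMSEQ_unique)
qed

text \<open>A Lyapunov estimate for the number of periods spent at or above \<open>b\<close>: with
  probability at least \<open>p\<close> the demand removes \<open>d0\<close> or more. The shift by
  \<open>d0\<close> makes this full decrease count even when the next level falls below
  \<open>b\<close>.\<close>

lemma one_plus_expected_excess_le:
  fixes d0 p :: real
  assumes d0: "0 < d0" and p: "0 < p" "p \<le> prob {\<omega> \<in> space M. d0 \<le> d \<omega>}" and "b \<le> y"
  shows "1 + expectation (\<lambda>\<omega>. max 0 (y - d \<omega> - b + d0)) / (p * d0) \<le> (y - b + d0) / (p * d0)"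
proof -
  let ?E = "{\<omega> \<in> space M. d0 \<le> d \<omega>}"
  have E: "?E \<in> sets M" by measurable
  have "expectation (\<lambda>\<omega>. max 0 (y - d \<omega> - b + d0)) \<le> expectation (\<lambda>\<omega>. (y - b + d0) - d0 * indicator ?E \<omega>)"
  proof (rule integral_mono)
    show "integrable M (\<lambda>\<omega>. max 0 (y - d \<omega> - b + d0))"
      using d_nonneg \<open>b \<le> y\<close> d0
      by (intro integrable_const_bound[where B = "y - b + d0"] AE_I2) auto
    show "integrable M (\<lambda>\<omega>. (y - b + d0) - d0 * indicator ?E \<omega>)"
      using E by (intro Bochner_Integration.integrable_diff integrable_mult_right)
        (auto simp: integrable_indicator_iff emeasure_eq_measure)
    show "max 0 (y - d \<omega> - b + d0) \<le> (y - b + d0) - d0 * indicator ?E \<omega>" if "\<omega> \<in> space M" for \<omega>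
      using that d_nonneg[OF that] \<open>b \<le> y\<close> d0 by (auto split: split_indicator)
  qed
  also have "\<dots> = (y - b + d0) - d0 * prob ?E"
    using E by (subst Bochner_Integration.integral_diff)
      (auto simp: integrable_indicator_iff emeasure_eq_measure prob_space intro!: integrable_mult_right)
  also have "\<dots> \<le> (y - b + d0) - d0 * p"
    using p d0 by simp
  finally have "expectation (\<lambda>\<omega>. max 0 (y - d \<omega> - b + d0)) / (p * d0) \<le> ((y - b + d0) - d0 * p) / (p * d0)"
    using p(1) d0 by (intro divide_right_mono) auto
  also have "\<dots> = (y - b + d0) / (p * d0) - 1"
    using p(1) d0 by (simp add: diff_divide_distrib)
  finally show ?thesis by simp
qed

text \<open>The factor of \<open>w\<close> bounds the expected number of periods until the larger
  state falls below \<open>b\<close>. Each period adds at most one oscillation \<open>w\<close> of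
  \<open>F\<close>, which \<open>g_step\<close> absorbs, and below \<open>b\<close> all iterates are
  constant.\<close>

lemma U_modulus:
  fixes d0 p w \<delta> R :: real
  assumes d0: "0 < d0" and p: "0 < p" "p \<le> prob {\<omega> \<in> space M. d0 \<le> d \<omega>}" and "0 \<le> w"
    and F: "\<And>x y. b \<le> x \<Longrightarrow> x \<le> y \<Longrightarrow> y \<le> R \<Longrightarrow> y - x \<le> \<delta> \<Longrightarrow> \<bar>F x - F y\<bar> \<le> w"
    and xy: "x \<le> y" "y \<le> R" "y - x \<le> \<delta>"
  shows "\<bar>U x - U y\<bar> \<le> w * (max 0 (y - b + d0) / (p * d0))"
proof -
  define g where "g = (\<lambda>z. max 0 (z - b + d0) / (p * d0))"
  have g_nonneg: "0 \<le> g z" for z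
    using d0 p(1) by (simp add: g_def)
  have g_mono: "g z \<le> g z'" if "z \<le> z'" for z z'
    using that d0 p(1) by (auto simp: g_def intro!: divide_right_mono)
  have [measurable]: "g \<in> borel_measurable borel"
    unfolding g_def by measurable
  have g_int: "integrable M (\<lambda>\<omega>. g (z - d \<omega>))" for z
    using g_nonneg d_nonneg
    by (intro integrable_const_bound[where B = "g z"] AE_I2) (auto intro!: g_mono)
  have g_step: "1 + expectation (\<lambda>\<omega>. g (z - d \<omega>)) \<le> g z" if "b \<le> z" for z
    using one_plus_expected_excess_le[OF d0 p that] that d0 by (simp add: g_def)
  have "\<bar>iter n x - iter n y\<bar> \<le> w * g y" if "x \<le> y" "y \<le> R" "y - x \<le> \<delta>" for n x y
    using that
  proof (induction n arbitrary: x y)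
    case 0
    then show ?case using \<open>0 \<le> w\<close> g_nonneg by (simp add: iter_simps)
  next
    case (Suc n)
    let ?f = "iter n"
    note f = iter_regular[of n]
    have J: "\<bar>J ?f x - J ?f y\<bar> \<le> w * g y" if "b \<le> x" "x \<le> y" "y \<le> R" "y - x \<le> \<delta>" for x y
    proof -
      have "\<bar>expectation (\<lambda>\<omega>. ?f (x - d \<omega>)) - expectation (\<lambda>\<omega>. ?f (y - d \<omega>))\<bar> =
          \<bar>expectation (\<lambda>\<omega>. ?f (x - d \<omega>) - ?f (y - d \<omega>))\<bar>"
        using regular_integrable[OF f] by simp
      also have "\<dots> \<le> expectation (\<lambda>\<omega>. \<bar>?f (x - d \<omega>) - ?f (y - d \<omega>)\<bar>)"
        by (rule integral_abs_bound)
      also have "\<dots> \<le> expectation (\<lambda>\<omega>. w * g (y - d \<omega>))"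
      proof (rule integral_mono)
        \<comment> \<open>Both levels face the same demand, so their gap is preserved. They may fall
          below \<open>b\<close>, which the induction hypothesis permits.\<close>
        fix \<omega> assume "\<omega> \<in> space M"
        then show "\<bar>?f (x - d \<omega>) - ?f (y - d \<omega>)\<bar> \<le> w * g (y - d \<omega>)"
          using d_nonneg[of \<omega>] that by (intro Suc.IH) auto
      qed (use regular_integrable[OF f] g_int in auto)
      also have "\<dots> = w * expectation (\<lambda>\<omega>. g (y - d \<omega>))"
        by simp
      finally have E: "\<bar>expectation (\<lambda>\<omega>. ?f (x - d \<omega>)) - expectation (\<lambda>\<omega>. ?f (y - d \<omega>))\<bar> \<le>
        w * expectation (\<lambda>\<omega>. g (y - d \<omega>))" (is "\<bar>?Ex - ?Ey\<bar> \<le> ?Eg") .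
      have "\<bar>J ?f x - J ?f y\<bar> = \<bar>(F x - F y) + \<alpha> * (?Ex - ?Ey)\<bar>"
        by (simp add: J_def algebra_simps)
      also have "\<dots> \<le> \<bar>F x - F y\<bar> + \<alpha> * \<bar>?Ex - ?Ey\<bar>"
        using abs_triangle_ineq[of "F x - F y" "\<alpha> * (?Ex - ?Ey)"] \<alpha> by (simp add: abs_mult)
      \<comment> \<open>Dropping the discount factor makes the bound independent of \<alpha>; the
        return of the state below \<open>b\<close>, not discounting, keeps the total finite.\<close>
      also have "\<dots> \<le> \<bar>F x - F y\<bar> + 1 * \<bar>?Ex - ?Ey\<bar>"
        using \<alpha> by (intro add_left_mono mult_right_mono) auto
      also have "\<dots> \<le> w + ?Eg"
        using F[OF that] E by simp
      also have "\<dots> = w * (1 + expectation (\<lambda>\<omega>. g (y - d \<omega>)))"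
        by (simp add: distrib_left)
      also have "\<dots> \<le> w * g y"
        using \<open>0 \<le> w\<close> g_step[of y] that by (intro mult_left_mono) auto
      finally show ?thesis .
    qed
    have T: "\<bar>T ?f x - T ?f y\<bar> \<le> w * g y" if xy: "b \<le> x" "x \<le> y" "y \<le> R" "y - x \<le> \<delta>" for x y
    proof -
      consider "S \<le> x" | "y \<le> S" | "x < S" "S < y" by linarith
      then show ?thesis
      proof cases
        case 1
        then show ?thesis using J[OF xy] xy by (simp add: T_def)
      next
        case 2
        then show ?thesis using J[OF xy] xy by (auto simp: T_left[OF f] min_def)
      next
        case 3
        obtain s where s: "S \<le> s" "J ?f s = min_J ?f"
          using min_J_attained[OF f] by metis
        \<comment> \<open>If the smaller state orders up to \<open>s\<close>, the larger one cannot
          copy this when \<open>s\<close> lies below \<open>y\<close>. In that case \<open>s\<close>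
          lies between \<open>x\<close> and \<open>y\<close>, so \<open>J\<close> at
          \<open>s\<close> and at \<open>y\<close> can be compared directly.\<close>
        have "J ?f y \<le> K + min_J ?f + w * g y"
        proof (cases "y \<le> s")
          case True
          then show ?thesis
            using J_setup_le[OF f, of y s] 3 s mult_nonneg_nonneg[OF \<open>0 \<le> w\<close> g_nonneg[of y]] by simp
        next
          case False
          then have "J ?f y \<le> J ?f s + w * g y"
            using J[of s y] 3 s xy b_less_S by simp
          then show ?thesis using s K_pos by simp
        qed
        then show ?thesis
          using J[OF xy] 3 by (auto simp: T_def min_def)
      qed
    qed
    consider "y \<le> b" | "x \<le> b" "b \<le> y" | "b \<le> x" by linarith
    then show ?case
    proof cases
      case 1
      then show ?thesis
        using T_below_b[OF f, of x] T_below_b[OF f, of y] Suc.prems \<open>0 \<le> w\<close> g_nonneg[of y]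
        by (simp add: iter_simps)
    next
      case 2
      \<comment> \<open>The state \<open>x\<close> is replaced by \<open>b\<close>, where
        \<open>T\<close> has the same value and which is closer to \<open>y\<close>.\<close>
      then have "\<bar>T ?f b - T ?f y\<bar> \<le> w * g y"
        using Suc.prems by (intro T) auto
      then show ?thesis
        using T_below_b[OF f] 2 by (simp add: iter_simps)
    next
      case 3
      then show ?thesis using T Suc.prems by (simp add: iter_simps)
    qed
  qed
  then have "\<bar>iter n x - iter n y\<bar> \<le> w * g y" for n
    using xy by blast
  then show ?thesis
    unfolding g_def
    by (intro tendsto_upperbound[OF tendsto_rabs[OF tendsto_diff[OF iter_tendsto iter_tendsto]]]) auto
qed

end

section \<open>The value function of the inventory model\<close>

declare One_nat_def [simp del] \<comment> \<open>otherwise \<open>D 1\<close> becomes \<open>D (Suc 0)\<close>\<close>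

text \<open>Truncation at 0 is subadditive. No signs are assumed because the iterates
  \<open>V n\<close> below may be negative.\<close>

lemma ennreal_add_le: "ennreal (p + q) \<le> ennreal p + ennreal q"
proof -
  have "ennreal (p + q) \<le> ennreal (max 0 p + max 0 q)"
    by (intro ennreal_leI) simp
  also have "\<dots> = ennreal p + ennreal q"
    by (simp add: ennreal_max_0)
  finally show ?thesis .
qed

lemma ennreal_integral_le_nn_integral:
  fixes f :: "'a \<Rightarrow> real"
  assumes "integrable M f"
  shows "ennreal (integral\<^sup>L M f) \<le> (\<integral>\<^sup>+x. ennreal (f x) \<partial>M)"
proof -
  have "ennreal (integral\<^sup>L M f) \<le> ennreal (\<integral>x. max 0 (f x) \<partial>M)"
    using assms by (intro ennreal_leI integral_mono) auto
  also have "\<dots> = (\<integral>\<^sup>+x. ennreal (max 0 (f x)) \<partial>M)"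
    using assms by (intro nn_integral_eq_integral[symmetric]) auto
  finally show ?thesis by (simp add: ennreal_max_0)
qed

section \<open>The model with real states\<close>

locale real_inventory_model = inventory_model M D UNIV "{0..}" K cbar h
  for M :: "'w measure" and D K cbar h
begin

definition L :: "real \<Rightarrow> real" where
  "L x = expectation (\<lambda>\<omega>. h (x - D 1 \<omega>))"

abbreviation ED :: real where
  "ED \<equiv> expectation (D 1)"

lemma L_cont: "continuous_on UNIV L"
  using holding_continuous unfolding L_def .

lemma L_nonneg: "0 \<le> L x"
  using holding_nonneg by (simp add: L_def)

lemma L_at_top: "filterlim L at_top at_top"
  using holding_coercive unfolding L_def by (rule filterlim_mono) (auto simp: at_top_le_at_infinity)

lemma ED_nonneg: "0 \<le> ED"
  using D_nonneg[of 1] by (intro Bochner_Integration.integral_nonneg) simp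

text \<open>Explicitly affine in \<alpha>: this gives the openness used for compactness in the
  discount factor, and reduces oscillations to those of \<open>L\<close>, which does not involve
  \<alpha>.\<close>

lemma expected_h_disc_eq: "expected_h_disc \<alpha> x = L x + (1 - \<alpha>) * cbar * x + \<alpha> * cbar * ED"
proof -
  have "expected_h_disc \<alpha> x =
      expectation (\<lambda>\<omega>. h (x - D 1 \<omega>) + ((1 - \<alpha>) * cbar * x + cbar * ED - (1 - \<alpha>) * cbar * D 1 \<omega>))"
    unfolding expected_h_disc_def h_disc_def by (simp add: algebra_simps)
  also have "\<dots> = L x + ((1 - \<alpha>) * cbar * x + cbar * ED - (1 - \<alpha>) * cbar * ED)"
    using holding_finite D_integrable unfolding L_def by (simp add: prob_space)
  finally show ?thesis by (simp add: algebra_simps)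
qed

lemma sets_state_space [measurable_cong]: "sets state_space = sets borel"
  by (simp add: state_space_def sets_restrict_space)

lemma space_state_space [simp]: "space state_space = UNIV"
  by (simp add: state_space_def space_restrict_space)

lemma space_action_space [simp]: "space action_space = {0..}"
  by (simp add: action_space_def space_restrict_space)

lemma action_measurable [measurable]: "(\<lambda>a. a) \<in> action_space \<rightarrow>\<^sub>M borel"
  unfolding action_space_def by (simp add: measurable_restrict_space1)

lemma step_cost_measurable [measurable]: "step_cost \<in> borel_measurable (state_space \<Otimes>\<^sub>M action_space)"
proof -
  have [measurable]: "L \<in> borel_measurable borel"
    using L_cont by (rule borel_measurable_continuous_onI)
  have [measurable]: "snd \<in> state_space \<Otimes>\<^sub>M action_space \<rightarrow>\<^sub>M borel"
    using measurable_compose[OF measurable_snd action_measurable] .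
  show ?thesis
    unfolding step_cost_def split_beta' L_def[symmetric] by measurable
qed

lemma step_cost_eq: "step_cost (x, a) = (if a > 0 then K else 0) + cbar * a + L (x + a)"
  by (simp add: step_cost_def L_def)

lemma step_cost_nonneg: "0 \<le> a \<Longrightarrow> 0 \<le> step_cost (x, a)"
  using K_pos cbar_pos L_nonneg by (simp add: step_cost_eq)

lemma nn_integral_transition:
  assumes [measurable]: "f \<in> borel_measurable borel"
  shows "(\<integral>\<^sup>+y. f y \<partial>transition (x, a)) = (\<integral>\<^sup>+\<omega>. f (x + a - D 1 \<omega>) \<partial>M)"
  unfolding transition_def prod.case
  by (rule nn_integral_distr) (simp_all add: measurable_cong_sets[OF refl sets_state_space]
    measurable_cong_sets[OF sets_state_space refl])

end

text \<open>By \<open>F_S\<close> and \<open>F_nonneg\<close>, the constant \<eta> is the minimum of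
  \<open>expected_h_disc \<alpha>\<close>, attained at \<open>S\<close>.\<close>

locale discounted_inventory_model =
  real_inventory_model M D K cbar h + setup_cost_problem M "D 1" F \<alpha> K b S R0
  for M :: "'w measure" and D K cbar h F \<alpha> b S R0 +
  fixes \<eta> :: real
  assumes F_eq: "\<And>x. F x = expected_h_disc \<alpha> x - \<eta>"
begin

lemma integrable_affine:
  "regular f \<Longrightarrow> integrable M (\<lambda>\<omega>. f (y - D 1 \<omega>) - cbar * (y - D 1 \<omega>) + e)"
  using regular_integrable[of f y] D_integrable by simp

text \<open>The ordering cost telescopes, which turns \<open>h\<close> into \<open>h_disc\<close>.\<close>

lemma step_cost_affine:
  assumes "regular f"
  shows "step_cost (x, a) + \<alpha> * expectation (\<lambda>\<omega>. f (x + a - D 1 \<omega>) - cbar * (x + a - D 1 \<omega>) + e) =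
    (if a > 0 then K else 0) + J f (x + a) - cbar * x + (\<eta> + \<alpha> * e)"
proof -
  have E: "expectation (\<lambda>\<omega>. f (x + a - D 1 \<omega>) - cbar * (x + a - D 1 \<omega>) + e) =
      expectation (\<lambda>\<omega>. f (x + a - D 1 \<omega>)) - cbar * (x + a - ED) + e"
    using regular_integrable[OF assms, of "x + a"] D_integrable by (simp add: prob_space)
  show ?thesis
    unfolding E by (simp add: step_cost_eq J_def F_eq expected_h_disc_eq algebra_simps)
qed

text \<open>Value iteration for the original costs, started from the terminal value
  \<open>- cbar * x\<close>, against which the unit ordering costs telescope. The geometric sum
  restores the subtracted minimum \<eta> of each period.\<close>

definition V :: "nat \<Rightarrow> real \<Rightarrow> real" where
  "V n x = iter n x - cbar * x + \<eta> * (\<Sum>k<n. \<alpha> ^ k)"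

definition W :: "real \<Rightarrow> real" where
  "W x = U x - cbar * x + \<eta> / (1 - \<alpha>)"

lemma V_measurable [measurable]: "V n \<in> borel_measurable borel"
  using regular_borel[OF iter_regular[of n]] unfolding V_def by measurable

lemma W_measurable [measurable]: "W \<in> borel_measurable borel"
  using regular_borel[OF U_regular] unfolding W_def by measurable

lemma W_integrable: "integrable M (\<lambda>\<omega>. W (y - D 1 \<omega>))"
  unfolding W_def by (rule integrable_affine[OF U_regular])

lemma V_tendsto: "(\<lambda>n. V n x) \<longlonglongrightarrow> W x"
proof -
  have "(\<lambda>n. \<Sum>k<n. \<alpha> ^ k) \<longlonglongrightarrow> 1 / (1 - \<alpha>)"
    using geometric_sums[of \<alpha>] \<alpha> by (simp add: sums_def)
  from tendsto_add[OF tendsto_diff[OF iter_tendsto tendsto_const] tendsto_mult[OF tendsto_const this]]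
  show ?thesis unfolding V_def W_def by simp
qed

lemma V_Suc_le:
  assumes "0 \<le> a"
  shows "V (Suc n) x \<le> step_cost (x, a) + \<alpha> * expectation (\<lambda>\<omega>. V n (x + a - D 1 \<omega>))"
proof -
  have "T (iter n) x \<le> (if a > 0 then K else 0) + J (iter n) (x + a)"
    using T_setup_le[OF iter_regular, of x "x + a" n] T_le_J[of "iter n" x] assms by auto
  moreover have "\<eta> * (\<Sum>k<Suc n. \<alpha> ^ k) = \<eta> + \<alpha> * (\<eta> * (\<Sum>k<n. \<alpha> ^ k))"
    unfolding sum.lessThan_Suc_shift by (simp add: algebra_simps sum_distrib_left)
  ultimately show ?thesis
    unfolding V_def step_cost_affine[OF iter_regular] by (simp add: iter_simps)
qed

lemma V_Suc_le_ennreal: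
  assumes "0 \<le> a"
  shows "ennreal (V (Suc n) x) \<le> ennreal (step_cost (x, a)) +
    ennreal \<alpha> * (\<integral>\<^sup>+y. ennreal (V n y) \<partial>transition (x, a))"
proof -
  have "ennreal (V (Suc n) x) \<le>
      ennreal (step_cost (x, a)) + ennreal (\<alpha> * expectation (\<lambda>\<omega>. V n (x + a - D 1 \<omega>)))"
    using ennreal_leI[OF V_Suc_le[OF assms]] ennreal_add_le by (rule order_trans)
  also have "\<dots> = ennreal (step_cost (x, a)) + ennreal \<alpha> * ennreal (expectation (\<lambda>\<omega>. V n (x + a - D 1 \<omega>)))"
    using \<alpha> by (simp add: ennreal_mult')
  also have "\<dots> \<le> ennreal (step_cost (x, a)) + ennreal \<alpha> * (\<integral>\<^sup>+\<omega>. ennreal (V n (x + a - D 1 \<omega>)) \<partial>M)"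
    unfolding V_def
    by (intro add_left_mono mult_left_mono ennreal_integral_le_nn_integral integrable_affine iter_regular) simp
  finally show ?thesis
    by (simp add: nn_integral_transition)
qed

text \<open>Ordering only lowers \<open>- cbar * x\<close>, and demand raises it by
  \<open>cbar * ED\<close> in expectation.\<close>

lemma V_0_drift:
  assumes "0 \<le> a"
  shows "(\<integral>\<^sup>+y. ennreal (V 0 y) \<partial>transition (x, a)) \<le> ennreal (V 0 x) + ennreal (cbar * ED)"
proof -
  have "(\<integral>\<^sup>+\<omega>. ennreal (V 0 (x + a - D 1 \<omega>)) \<partial>M) \<le> (\<integral>\<^sup>+\<omega>. ennreal (V 0 x) + ennreal (cbar * D 1 \<omega>) \<partial>M)"
  proof (intro nn_integral_mono)
    fix \<omega>
    have "0 \<le> cbar * a"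
      using cbar_pos assms by simp
    then have "V 0 (x + a - D 1 \<omega>) \<le> V 0 x + cbar * D 1 \<omega>"
      by (simp add: V_def iter_simps algebra_simps)
    then show "ennreal (V 0 (x + a - D 1 \<omega>)) \<le> ennreal (V 0 x) + ennreal (cbar * D 1 \<omega>)"
      using ennreal_add_le order_trans ennreal_leI by blast
  qed
  also have "\<dots> = ennreal (V 0 x) + (\<integral>\<^sup>+\<omega>. ennreal (cbar * D 1 \<omega>) \<partial>M)"
    by (simp add: nn_integral_add emeasure_space_1)
  also have "(\<integral>\<^sup>+\<omega>. ennreal (cbar * D 1 \<omega>) \<partial>M) = ennreal (cbar * ED)"
    using D_integrable D_nonneg[of 1] cbar_pos by (subst nn_integral_eq_integral) auto
  finally show ?thesis
    by (simp add: nn_integral_transition)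
qed

text \<open>Unrolling \<open>V n\<close> along an arbitrary policy leaves a terminal term of order
  \<open>n * \<alpha> ^ n\<close>, by the drift bound; letting \<open>n\<close> tend to infinity
  removes it.\<close>

lemma W_le_v: "ennreal (W x) \<le> v \<alpha> x"
  unfolding v_def discounted_value_def
proof (rule INF_greatest)
  fix \<pi> assume "\<pi> \<in> policies state_space action_space"
  then interpret mdp_trajectory state_space action_space transition \<pi> x
    using transition_measurable by unfold_locales simp_all
  let ?c = "\<lambda>t. ennreal \<alpha> ^ t * (\<integral>\<^sup>+\<omega>. ennreal (step_cost (\<omega> t)) \<partial>law)"
  let ?r = "\<lambda>n. \<alpha> ^ n * max 0 (V 0 x) + cbar * ED * (of_nat n * \<alpha> ^ n)"
  have "ennreal (V n x) \<le> (\<Sum>t. ?c t) + ennreal (?r n)" for n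
  proof -
    have "ennreal (V n x) \<le> (\<Sum>t<n. ?c t) + ennreal \<alpha> ^ n * (\<integral>\<^sup>+\<omega>. ennreal (V 0 (fst (\<omega> n))) \<partial>law)"
      by (rule cost_to_go_le[where f = "\<lambda>n y. ennreal (V n y)"]) 
         (auto intro: V_Suc_le_ennreal simp: measurable_cong_sets[OF sets_state_space refl])
    also have "\<dots> \<le> (\<Sum>t. ?c t) + ennreal \<alpha> ^ n * (ennreal (V 0 x) + of_nat n * ennreal (cbar * ED))"
      by (intro add_mono mult_left_mono sum_le_suminf nn_integral_state_drift_le) 
         (auto intro: V_0_drift simp: measurable_cong_sets[OF sets_state_space refl])
    also have "ennreal \<alpha> ^ n * (ennreal (V 0 x) + of_nat n * ennreal (cbar * ED)) = ennreal (?r n)"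
    proof -
      have "ennreal (V 0 x) + of_nat n * ennreal (cbar * ED) = ennreal (max 0 (V 0 x) + of_nat n * (cbar * ED))"
        using cbar_pos ED_nonneg
        by (simp add: ennreal_max_0 ennreal_mult ennreal_of_nat_eq_real_of_nat)
      then show ?thesis
        using \<alpha> cbar_pos ED_nonneg
        by (simp add: ennreal_power ennreal_mult[symmetric] algebra_simps del: ennreal_plus)
    qed
    finally show ?thesis .
  qed
  moreover have "(\<lambda>n. ennreal (V n x)) \<longlonglongrightarrow> ennreal (W x)"
    using V_tendsto by (rule tendsto_ennrealI)
  moreover have "(\<lambda>n. (\<Sum>t. ?c t) + ennreal (?r n)) \<longlonglongrightarrow> (\<Sum>t. ?c t) + ennreal (0 * max 0 (V 0 x) + cbar * ED * 0)"
    using \<alpha> by (intro tendsto_intros tendsto_ennrealI LIMSEQ_realpow_zero powser_times_n_limit_0) auto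
  ultimately have "ennreal (W x) \<le> (\<Sum>t. ?c t) + ennreal (0 * max 0 (V 0 x) + cbar * ED * 0)"
    by (intro LIMSEQ_le) auto
  then show "ennreal (W x) \<le> discounted_cost state_space action_space transition step_cost \<alpha> \<pi> x"
    using \<alpha> by (simp add: discounted_cost_eq)
qed

text \<open>The threshold policy read off from \<open>T U = U\<close>: order up to a minimiser of
  \<open>J U\<close> when this is strictly cheaper. The bound by \<open>max x R0\<close> keeps
  half-lines invariant and serves \<open>W_nonneg\<close>.\<close>

lemma optimal_action:
  obtains \<phi> where "\<phi> \<in> borel_measurable borel" "\<And>x. 0 \<le> \<phi> x"
    "\<And>x. x + \<phi> x \<le> max x R0"
    "\<And>x. W x = step_cost (x, \<phi> x) + \<alpha> * expectation (\<lambda>\<omega>. W (x + \<phi> x - D 1 \<omega>))"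
proof -
  obtain s where s: "S \<le> s" "s \<le> R0" "J U s = min_J U"
    using min_J_attained[OF U_regular] by metis
  define \<phi> where "\<phi> = (\<lambda>x. if x < S \<and> K + min_J U < J U x then s - x else 0)"
  \<comment> \<open>The constant of \<open>W\<close> reproduces itself: one period adds \<eta> and
    discounts the rest.\<close>
  have e: "\<eta> + \<alpha> * (\<eta> / (1 - \<alpha>)) = \<eta> / (1 - \<alpha>)"
    using \<alpha> by (simp add: field_simps)
  show ?thesis
  proof (rule that[of \<phi>])
    have [measurable]: "J U \<in> borel_measurable borel"
      using J_cont[OF U_regular] by (rule borel_measurable_continuous_onI)
    show "\<phi> \<in> borel_measurable borel"
      unfolding \<phi>_def by measurable
    show "0 \<le> \<phi> x" "x + \<phi> x \<le> max x R0" for x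
      using s by (auto simp: \<phi>_def)
    fix x
    have "U x = (if \<phi> x > 0 then K else 0) + J U (x + \<phi> x)"
      using fun_cong[OF T_U, of x] s by (auto simp: T_def \<phi>_def split: if_splits)
    then show "W x = step_cost (x, \<phi> x) + \<alpha> * expectation (\<lambda>\<omega>. W (x + \<phi> x - D 1 \<omega>))"
      unfolding W_def step_cost_affine[OF U_regular] e by simp
  qed
qed

text \<open>Needed because \<open>ennreal\<close> truncates. On a half-line containing
  \<open>x\<close> and invariant under the optimal action, \<open>W\<close> is bounded below. As
  step costs are nonnegative, its infimum \<open>I\<close> there satisfies
  \<open>\<alpha> * I \<le> I\<close>, hence is nonnegative.\<close>

lemma W_nonneg: "0 \<le> W x"
proof -
  obtain \<phi> where \<phi>: "\<And>x. 0 \<le> \<phi> x" "\<And>x. x + \<phi> x \<le> max x R0"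
      "\<And>x. W x = step_cost (x, \<phi> x) + \<alpha> * expectation (\<lambda>\<omega>. W (x + \<phi> x - D 1 \<omega>))"
    using optimal_action by metis
  define R where "R = max x R0"
  define I where "I = Inf (W ` {..R})"
  have "W z \<ge> - cbar * R + \<eta> / (1 - \<alpha>)" if "z \<le> R" for z
    using regularD(2)[OF U_regular, of z] mult_left_mono[OF that less_imp_le[OF cbar_pos]]
    unfolding W_def by linarith
  then have bdd: "bdd_below (W ` {..R})"
    by (auto intro!: bdd_belowI2)
  have I: "I \<le> W z" if "z \<le> R" for z
    unfolding I_def using bdd that by (intro cInf_lower) auto
  have "\<alpha> * I \<le> I"

  proof -
    have "\<alpha> * I \<le> W z" if "z \<le> R" for z
    proof -
      have "expectation (\<lambda>_. I) \<le> expectation (\<lambda>\<omega>. W (z + \<phi> z - D 1 \<omega>))"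
      proof (rule integral_mono)
        show "integrable M (\<lambda>\<omega>. W (z + \<phi> z - D 1 \<omega>))"
          by (rule W_integrable)
        show "I \<le> W (z + \<phi> z - D 1 \<omega>)" if "\<omega> \<in> space M" for \<omega>
          using D_nonneg[OF _ that, of 1] \<phi>(2)[of z] \<open>z \<le> R\<close> by (intro I) (auto simp: R_def)
      qed simp
      then have "\<alpha> * I \<le> \<alpha> * expectation (\<lambda>\<omega>. W (z + \<phi> z - D 1 \<omega>))"
        using \<alpha> by (intro mult_left_mono) (auto simp: prob_space)
      also have "\<dots> \<le> W z"
        using \<phi>(3)[of z] step_cost_nonneg[OF \<phi>(1), of z z] by simp
      finally show ?thesis .
    qed
    then show "\<alpha> * I \<le> I"
      unfolding I_def by (intro cInf_greatest) auto
  qed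
  then have "0 \<le> I * (1 - \<alpha>)"
    by (simp add: algebra_simps)
  then have "0 \<le> I"
    using \<alpha> by (simp add: zero_le_mult_iff)
  then show ?thesis
    using I[of x] by (simp add: R_def)
qed

text \<open>\<open>W\<close> satisfies the optimality equation with equality under the optimal
  action, and its nonnegativity transfers the equation to \<open>ennreal\<close>.\<close>

lemma v_le_W: "v \<alpha> x \<le> ennreal (W x)"
proof -
  obtain \<phi> where [measurable]: "\<phi> \<in> borel_measurable borel" and \<phi>: "\<And>x. 0 \<le> \<phi> x"
      "\<And>x. W x = step_cost (x, \<phi> x) + \<alpha> * expectation (\<lambda>\<omega>. W (x + \<phi> x - D 1 \<omega>))"
    using optimal_action by metis
  show ?thesis
    unfolding v_def
  proof (rule discounted_value_le_supersolution[OF transition_measurable])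
    show "\<phi> \<in> state_space \<rightarrow>\<^sub>M action_space"
      unfolding action_space_def using \<phi>(1)
      by (intro measurable_restrict_space2) (auto simp: measurable_cong_sets[OF sets_state_space refl])
    fix y
    have "(\<integral>\<^sup>+y'. ennreal (W y') \<partial>transition (y, \<phi> y)) = ennreal (expectation (\<lambda>\<omega>. W (y + \<phi> y - D 1 \<omega>)))"
      by (simp add: nn_integral_transition nn_integral_eq_integral W_nonneg W_integrable)
    then show "ennreal (step_cost (y, \<phi> y)) + ennreal \<alpha> * (\<integral>\<^sup>+y'. ennreal (W y') \<partial>transition (y, \<phi> y)) \<le> ennreal (W y)"
      using \<alpha> step_cost_nonneg[OF \<phi>(1)] W_nonneg
      by (subst \<phi>(2)[of y]) (simp add: ennreal_mult[symmetric] ennreal_plus[symmetric] Bochner_Integration.integral_nonneg del: ennreal_plus)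
  qed (use \<alpha> in \<open>auto simp: measurable_cong_sets[OF sets_state_space refl]\<close>)
qed

lemma enn2real_v: "enn2real (v \<alpha> x) = W x"
  using order_antisym[OF v_le_W W_le_v, of x] W_nonneg[of x] by simp

text \<open>The infimum \<open>m \<alpha>\<close> cancels in the difference. Passing from
  \<open>L\<close> to \<open>F\<close> adds a linear term of slope at most \<open>cbar\<close>, and
  passing from \<open>U\<close> to \<open>W\<close> adds another; these are the two terms
  \<open>cbar * \<delta>\<close>.\<close>

lemma u_modulus:
  fixes d0 p w \<delta> R :: real
  assumes "0 < d0" "0 < p" "p \<le> prob {\<omega> \<in> space M. d0 \<le> D 1 \<omega>}" and "0 \<le> w"
    and L: "\<And>x y. b \<le> x \<Longrightarrow> x \<le> y \<Longrightarrow> y \<le> R \<Longrightarrow> y - x \<le> \<delta> \<Longrightarrow> \<bar>L x - L y\<bar> \<le> w"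
    and xy: "x \<le> y" "y \<le> R" "y - x \<le> \<delta>"
  shows "\<bar>u \<alpha> x - u \<alpha> y\<bar> \<le> (w + cbar * \<delta>) * (max 0 (y - b + d0) / (p * d0)) + cbar * \<delta>"
proof -
  have lin: "(1 - \<alpha>) * cbar * (y - x) \<le> cbar * \<delta>" "0 \<le> (1 - \<alpha>) * cbar * (y - x)"
    if "x \<le> y" "y - x \<le> \<delta>" for x y
  proof -
    have "(1 - \<alpha>) * (cbar * (y - x)) \<le> 1 * (cbar * \<delta>)"
      using \<alpha> cbar_pos that by (intro mult_mono) auto
    then show "(1 - \<alpha>) * cbar * (y - x) \<le> cbar * \<delta>" by (simp add: mult_ac)
    show "0 \<le> (1 - \<alpha>) * cbar * (y - x)"
      using \<alpha> cbar_pos that by simp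
  qed
  have "\<bar>U x - U y\<bar> \<le> (w + cbar * \<delta>) * (max 0 (y - b + d0) / (p * d0))"
  proof (rule U_modulus[OF assms(1-3) _ _ xy])
    show "0 \<le> w + cbar * \<delta>"
      using \<open>0 \<le> w\<close> cbar_pos xy by simp
    fix x y assume that: "b \<le> x" "x \<le> y" "y \<le> R" "y - x \<le> \<delta>"
    have "F x - F y = (L x - L y) - (1 - \<alpha>) * cbar * (y - x)"
      by (simp add: F_eq expected_h_disc_eq algebra_simps)
    then show "\<bar>F x - F y\<bar> \<le> w + cbar * \<delta>"
      using L[OF that] lin[OF that(2,4)] by linarith
  qed
  moreover have "u \<alpha> x - u \<alpha> y = (U x - U y) + cbar * (y - x)"
    by (simp add: u_def enn2real_v W_def algebra_simps)
  moreover have "0 \<le> cbar * (y - x)" "cbar * (y - x) \<le> cbar * \<delta>"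
    using xy cbar_pos by simp_all
  ultimately show ?thesis by linarith
qed

end

section \<open>Uniformity in the discount factor\<close>

lemma quasiconvex_on_UNIV_between:
  assumes "quasiconvex_on UNIV f" "x \<le> y" "y \<le> z"
  shows "f y \<le> max (f x) (f z)"
proof (cases "x = z")
  case False
  define l where "l = (z - y) / (z - x)"
  have l: "l * (z - x) = z - y" "l \<in> {0..1}"
    using assms(2,3) False by (auto simp: l_def)
  then have y: "l * x + (1 - l) * z = y"
    by (simp add: algebra_simps)
  have "f (l * x + (1 - l) * z) \<le> max (f x) (f z)"
    using assms(1) l(2) unfolding quasiconvex_on_def by blast
  then show ?thesis
    unfolding y .
qed (use assms in auto)

text \<open>Distinct integers are at distance at least 1, so singletons are relatively open.\<close>

lemma equicontinuous_on_Ints: "equicontinuous_on (\<int> :: real set) \<F>"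
  unfolding equicontinuous_on_def equicontinuous_at_within_def
proof (intro ballI allI impI)
  fix x e :: real assume "x \<in> \<int>" "0 < e"
  have "y = x" if "y \<in> \<int>" "\<bar>x - y\<bar> < 1" for y
    using Ints_nonzero_abs_less1[of "x - y"] Ints_diff[OF \<open>x \<in> \<int>\<close> that(1)] that(2) by auto
  then have "{x} = \<int> \<inter> ball x 1"
    using \<open>x \<in> \<int>\<close> by (auto simp: dist_real_def)
  then have "openin (top_of_set \<int>) {x}"
    unfolding openin_open by (intro exI[of _ "ball x 1"]) simp
  then show "\<exists>G. openin (top_of_set \<int>) G \<and> x \<in> G \<and> (\<forall>y\<in>G. \<forall>f\<in>\<F>. \<bar>f y - f x\<bar> < e)"
    using \<open>0 < e\<close> by (intro exI[of _ "{x}"]) simp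
qed

text \<open>The event that \<open>f\<close> is positive is the countable union of the events that
  \<open>f\<close> is at least \<open>1 / Suc n\<close>, which cannot all be null.\<close>

lemma (in prob_space) exists_pos_lower_bound:
  fixes f :: "'a \<Rightarrow> real"
  assumes [measurable]: "f \<in> borel_measurable M" and pos: "0 < prob {\<omega> \<in> space M. 0 < f \<omega>}"
  obtains c where "0 < c" "0 < prob {\<omega> \<in> space M. c \<le> f \<omega>}"
proof -
  have "\<exists>n. 0 < prob {\<omega> \<in> space M. 1 / Suc n \<le> f \<omega>}"
  proof (rule ccontr)
    assume "\<nexists>n. 0 < prob {\<omega> \<in> space M. 1 / Suc n \<le> f \<omega>}"
    then have "prob {\<omega> \<in> space M. 1 / Suc n \<le> f \<omega>} = 0" for n
      by (simp add: not_less measure_le_0_iff)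
    then have "AE \<omega> in M. \<not> 1 / Suc n \<le> f \<omega>" for n
      by (intro AE_I[where N = "{\<omega> \<in> space M. 1 / Suc n \<le> f \<omega>}"]) (auto simp: emeasure_eq_measure)
    then have "AE \<omega> in M. \<forall>n. \<not> 1 / Suc n \<le> f \<omega>"
      by (simp add: AE_all_countable)
    then have "AE \<omega> in M. \<not> 0 < f \<omega>"
    proof eventually_elim
      case (elim \<omega>)
      then show ?case
        using reals_Archimedean[of "f \<omega>"] by (metis inverse_eq_divide less_imp_le)
    qed
    then have "prob {\<omega> \<in> space M. 0 < f \<omega>} = 0"
      by (subst prob_eq_0) auto
    with pos show False by simp
  qed
  then show ?thesis
    using that by (metis of_nat_0_less_iff zero_less_Suc zero_less_divide_1_iff)
qed

section \<open>Thresholds common to all discount factors\<close>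

context real_inventory_model
begin

lemma expected_h_disc_cont: "continuous_on UNIV (expected_h_disc \<alpha>)"
  unfolding expected_h_disc_eq[abs_def] by (intro continuous_intros L_cont)

text \<open>Turns the limit condition into a strict inequality between two points, which is stable
  under small changes of \<alpha>. The limit may be infinite, hence the case distinction on
  \<open>l\<close>.\<close>

lemma setup_profitable:
  assumes "((\<lambda>x. ereal (expected_h_disc \<alpha> x)) \<longlongrightarrow> l) at_bot"
    and "l > ereal K + (INF x. ereal (expected_h_disc \<alpha> x))"
  obtains b s where "b < s" "K + expected_h_disc \<alpha> s < expected_h_disc \<alpha> b"
proof -
  have "\<exists>s. ereal (K + expected_h_disc \<alpha> s) < l"
  proof (rule ccontr)
    assume "\<nexists>s. ereal (K + expected_h_disc \<alpha> s) < l"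
    then have *: "l \<le> ereal (K + expected_h_disc \<alpha> s)" for s
      by (simp add: not_less)
    show False
    proof (cases l)
      case (real r)
      then have "ereal (r - K) \<le> (INF x. ereal (expected_h_disc \<alpha> x))"
        using * by (intro INF_greatest) (simp add: algebra_simps)
      then have "ereal K + ereal (r - K) \<le> ereal K + (INF x. ereal (expected_h_disc \<alpha> x))"
        by (rule add_left_mono)
      with real assms(2) show False by simp
    next
      case PInf
      then show False using *[of 0] by simp
    next
      case MInf
      then show False using assms(2) by simp
    qed
  qed
  then obtain s where "ereal (K + expected_h_disc \<alpha> s) < l" ..
  with assms(1) have "\<forall>\<^sub>F x in at_bot. ereal (K + expected_h_disc \<alpha> s) < ereal (expected_h_disc \<alpha> x)"
    by (rule order_tendstoD)
  then have "\<forall>\<^sub>F x in at_bot. x < s \<and> K + expected_h_disc \<alpha> s < expected_h_disc \<alpha> x"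
    using eventually_gt_at_bot[of s] by eventually_elim simp
  then show ?thesis
    using that by (auto dest!: eventually_happens'[OF trivial_limit_at_bot_linorder])
qed

text \<open>For fixed points \<open>b\<close> and \<open>s\<close> the inequality holds on an open
  set of \<alpha>. Finitely many pairs cover the compact interval, which is where the value 1
  enters, and the least of their left points works for all \<alpha>.\<close>

lemma setup_profitable_uniform:
  assumes "\<beta> \<le> 1"
    and quasiconvex: "\<And>\<alpha>. \<alpha> \<in> {\<beta>..1} \<Longrightarrow> quasiconvex_on UNIV (expected_h_disc \<alpha>)"
    and profitable: "\<And>\<alpha>. \<alpha> \<in> {\<beta>..1} \<Longrightarrow> \<exists>b s. b < s \<and> K + expected_h_disc \<alpha> s < expected_h_disc \<alpha> b"
  obtains b where "\<And>\<alpha>. \<alpha> \<in> {\<beta>..1} \<Longrightarrow> \<exists>s>b. K + expected_h_disc \<alpha> s < expected_h_disc \<alpha> b"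
proof -
  define G where "G = (\<lambda>(b, s). {\<alpha>. K + expected_h_disc \<alpha> s < expected_h_disc \<alpha> b})"
  have op: "open (G z)" for z
    unfolding G_def expected_h_disc_eq by (cases z) (auto intro!: open_Collect_less continuous_intros)
  have cover: "{\<beta>..1} \<subseteq> (\<Union>z\<in>{(b, s). b < s}. G z)"
  proof
    fix \<alpha> assume "\<alpha> \<in> {\<beta>..1}"
    from profitable[OF this] obtain b s where "b < s" "\<alpha> \<in> G (b, s)"
      by (auto simp: G_def)
    then show "\<alpha> \<in> (\<Union>z\<in>{(b, s). b < s}. G z)"
      by (intro UN_I[of "(b, s)"]) simp_all
  qed
  obtain Z where Z: "Z \<subseteq> {(b, s). b < s}" "finite Z" "{\<beta>..1} \<subseteq> (\<Union>z\<in>Z. G z)"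
    by (rule compactE_image[OF compact_Icc op cover])
  show ?thesis
  proof (rule that[of "Min (fst ` Z)"])
    fix \<alpha> assume \<alpha>: "\<alpha> \<in> {\<beta>..1}"
    with Z(3) obtain b s where bs: "(b, s) \<in> Z" "K + expected_h_disc \<alpha> s < expected_h_disc \<alpha> b"
      by (auto simp: G_def)
    have "b < s" using bs Z(1) by auto
    have le: "Min (fst ` Z) \<le> b"
      using Z(2) bs(1) by (intro Min_le) (auto intro: rev_image_eqI)
    \<comment> \<open>As the value at \<open>s\<close> is smaller than that at \<open>b\<close>, the
      maximum bounds the value at \<open>b\<close> by that at the least left point.\<close>
    have "expected_h_disc \<alpha> b \<le> max (expected_h_disc \<alpha> (Min (fst ` Z))) (expected_h_disc \<alpha> s)"
      using quasiconvex_on_UNIV_between[OF quasiconvex[OF \<alpha>] le, of s] \<open>b < s\<close> by simp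
    then show "\<exists>s>Min (fst ` Z). K + expected_h_disc \<alpha> s < expected_h_disc \<alpha> (Min (fst ` Z))"
      using bs(2) K_pos le \<open>b < s\<close> by (intro exI[of _ s]) auto
  qed
qed

lemma expected_h_disc_at_top:
  assumes "0 \<le> \<alpha>" "\<alpha> \<le> 1"
  shows "filterlim (expected_h_disc \<alpha>) at_top at_top"
proof (rule filterlim_at_top_mono[OF L_at_top])
  show "\<forall>\<^sub>F x in at_top. L x \<le> expected_h_disc \<alpha> x"
    using eventually_ge_at_top[of 0]
    by eventually_elim (use assms cbar_pos ED_nonneg in \<open>simp add: expected_h_disc_eq\<close>)
qed

text \<open>Beyond \<open>b\<close> on the left and \<open>R\<close> on the right the values are at
  least that at \<open>s\<close>, so a minimiser \<open>S\<close> over \<open>[b, R]\<close> is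
  global. Quasiconvexity then gives monotonicity on both sides of \<open>S\<close>, and growth at
  infinity gives \<open>R0\<close>.\<close>

lemma discounted_inventory_model_exists:
  assumes \<alpha>: "0 \<le> \<alpha>" "\<alpha> < 1"
    and quasiconvex: "quasiconvex_on UNIV (expected_h_disc \<alpha>)"
    and s: "b < s" "K + expected_h_disc \<alpha> s < expected_h_disc \<alpha> b"
  obtains S R0 \<eta> where
    "discounted_inventory_model M D K cbar h (\<lambda>x. expected_h_disc \<alpha> x - \<eta>) \<alpha> b S R0 \<eta>"
proof -
  let ?H = "expected_h_disc \<alpha>"
  note between = quasiconvex_on_UNIV_between[OF quasiconvex]
  have left: "?H b \<le> ?H x" if "x \<le> b" for x
    using between[OF that, of s] s K_pos by auto
  have at_top: "\<exists>R\<ge>r. \<forall>x\<ge>R. c \<le> ?H x" for c r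
  proof -
    obtain N where "\<And>x. N \<le> x \<Longrightarrow> c \<le> ?H x"
      using expected_h_disc_at_top[of \<alpha>] \<alpha> by (auto simp: filterlim_at_top eventually_at_top_linorder)
    then show ?thesis
      by (intro exI[of _ "max r N"]) simp
  qed
  obtain R where R: "s \<le> R" "\<And>x. R \<le> x \<Longrightarrow> ?H s \<le> ?H x"
    using at_top by metis
  obtain S where S: "S \<in> {b..R}" "\<And>x. x \<in> {b..R} \<Longrightarrow> ?H S \<le> ?H x"
    using continuous_attains_inf[of "{b..R}" ?H] continuous_on_subset[OF expected_h_disc_cont] s R by auto
  have Hs: "?H S \<le> ?H s"
    using S(2)[of s] s R by simp
  have min: "?H S \<le> ?H x" for x
    using S(2)[of x] left[of x] R(2)[of x] Hs s K_pos by (cases "x < b"; cases "R < x") auto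
  have "b < S"
    using S(1) Hs s K_pos by (cases "b = S") auto
  obtain R0 where R0: "S \<le> R0" "\<And>x. R0 \<le> x \<Longrightarrow> K + ?H S \<le> ?H x"
    using at_top by metis
  show ?thesis
  proof (rule that, unfold_locales)
    show "continuous_on UNIV (\<lambda>x. ?H x - ?H S)"
      by (intro continuous_intros expected_h_disc_cont)
    show "?H y - ?H S \<le> ?H x - ?H S" if "x \<le> y" "y \<le> S" for x y
      using between[OF that] min[of x] by simp
    show "?H x - ?H S \<le> ?H y - ?H S" if "S \<le> x" "x \<le> y" for x y
      using between[OF that] min[of y] by simp
    show "K \<le> ?H x - ?H S" if "x \<le> b" for x
      using left[OF that] Hs s by simp
    show "K \<le> ?H x - ?H S" if "R0 \<le> x" for x
      using R0(2)[OF that] by simp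
  qed (use \<alpha> \<open>b < S\<close> R0 min D_nonneg K_pos in auto)
qed

text \<open>\<open>S\<close>, \<open>R0\<close> and \<eta> vary with \<alpha>, but the bound in
  \<open>u_modulus\<close> involves only \<open>b\<close>, \<open>d0\<close>, the probability of
  demand at least \<open>d0\<close>, \<open>cbar\<close> and the modulus of continuity of
  \<open>L\<close>.\<close>

lemma equicontinuous_u:
  assumes "0 \<le> \<beta>"
    and quasiconvex: "\<And>\<alpha>. \<alpha> \<in> {\<beta>..<1} \<Longrightarrow> quasiconvex_on UNIV (expected_h_disc \<alpha>)"
    and b: "\<And>\<alpha>. \<alpha> \<in> {\<beta>..<1} \<Longrightarrow> \<exists>s>b. K + expected_h_disc \<alpha> s < expected_h_disc \<alpha> b"
  shows "equicontinuous_on UNIV {u \<alpha> |\<alpha>. \<alpha> \<in> {\<beta>..<1}}"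
  unfolding equicontinuous_on_def equicontinuous_at_within_def
proof (intro ballI allI impI)
  fix x e :: real assume "0 < e"
  obtain d0 where d0: "0 < d0" "0 < prob {\<omega> \<in> space M. d0 \<le> D 1 \<omega>}" (is "0 < ?p")
    using exists_pos_lower_bound[OF D_measurable D_nontrivial] by blast
  define C where "C = max 0 (x + 1 - b + d0) / (?p * d0)"
  have "0 \<le> C" using d0 by (simp add: C_def)
  \<comment> \<open>With \<open>cbar * \<delta> \<le> w\<close> the final bound becomes
    \<open>2 * w * C + w\<close>, which is at most \<open>e / 2\<close>.\<close>
  define w where "w = e / (4 * (C + 1))"
  have "0 < w" using \<open>0 < e\<close> \<open>0 \<le> C\<close> by (simp add: w_def)
  have "uniformly_continuous_on {b..x + 1} L"
    by (intro compact_uniformly_continuous continuous_on_subset[OF L_cont]) auto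
  then obtain r where r: "0 < r"
      "\<And>y z. y \<in> {b..x + 1} \<Longrightarrow> z \<in> {b..x + 1} \<Longrightarrow> dist z y < r \<Longrightarrow> dist (L z) (L y) < w"
    using \<open>0 < w\<close> unfolding uniformly_continuous_on_def by metis
  \<comment> \<open>The cap 1 keeps nearby states below \<open>x + 1\<close>, the level at which
    \<open>C\<close> is evaluated.\<close>
  define \<delta> where "\<delta> = min (r / 2) (min 1 (w / cbar))"
  have \<delta>: "0 < \<delta>" "\<delta> < r" "\<delta> \<le> 1" "\<delta> \<le> w / cbar"
    using r(1) \<open>0 < w\<close> cbar_pos by (auto simp: \<delta>_def)
  then have "cbar * \<delta> \<le> w"
    using cbar_pos by (simp add: field_simps)
  have bound: "\<bar>u \<alpha> y - u \<alpha> z\<bar> < e" if \<alpha>: "\<alpha> \<in> {\<beta>..<1}" and yz: "y \<le> z" "z \<le> x + 1" "z - y \<le> \<delta>" for \<alpha> y z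
  proof -
    have "0 \<le> \<alpha>" "\<alpha> < 1"
      using \<alpha> \<open>0 \<le> \<beta>\<close> by auto
    moreover obtain s where "b < s" "K + expected_h_disc \<alpha> s < expected_h_disc \<alpha> b"
      using b[OF \<alpha>] by blast
    ultimately obtain S R0 \<eta> where
      "discounted_inventory_model M D K cbar h (\<lambda>x. expected_h_disc \<alpha> x - \<eta>) \<alpha> b S R0 \<eta>"
      using quasiconvex[OF \<alpha>] by (elim discounted_inventory_model_exists)
    then interpret discounted_inventory_model M D K cbar h "\<lambda>x. expected_h_disc \<alpha> x - \<eta>" \<alpha> b S R0 \<eta> .
    have "\<bar>L y - L z\<bar> \<le> w" if "b \<le> y" "y \<le> z" "z \<le> x + 1" "z - y \<le> \<delta>" for y z
      using r(2)[of z y] that \<delta> by (simp add: dist_real_def less_imp_le)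
    then have "\<bar>u \<alpha> y - u \<alpha> z\<bar> \<le> (w + cbar * \<delta>) * (max 0 (z - b + d0) / (?p * d0)) + cbar * \<delta>"
      using \<open>0 < w\<close> yz d0 by (intro u_modulus[where R = "x + 1"]) auto
    also have "\<dots> \<le> (w + w) * C + w"
      unfolding C_def using \<open>0 < w\<close> \<open>cbar * \<delta> \<le> w\<close> yz d0
      by (intro add_mono mult_mono divide_right_mono) auto
    also have "\<dots> \<le> 2 * (w * (C + 1))"
      using \<open>0 < w\<close> by (simp add: algebra_simps)
    also have "w * (C + 1) = e / 4"
      using \<open>0 \<le> C\<close> by (simp add: w_def field_simps)
    finally show ?thesis using \<open>0 < e\<close> by simp
  qed
  have "\<bar>u \<alpha> y - u \<alpha> x\<bar> < e" if "y \<in> ball x \<delta>" "\<alpha> \<in> {\<beta>..<1}" for y \<alpha>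
    using bound[OF that(2), of x y] bound[OF that(2), of y x] that(1) \<delta>
    by (cases "y \<le> x") (auto simp: dist_real_def abs_minus_commute)
  then show "\<exists>G. openin (top_of_set UNIV) G \<and> x \<in> G \<and>
      (\<forall>y\<in>G. \<forall>f\<in>{u \<alpha> |\<alpha>. \<alpha> \<in> {\<beta>..<1}}. \<bar>f y - f x\<bar> < e)"
    using \<delta>(1) by (intro exI[of _ "ball x \<delta>"]) auto
qed

end

theorem theorem4p6:
  fixes M :: "'w measure"
    and D :: "nat \<Rightarrow> 'w \<Rightarrow> real"
    and X A :: "real set"
    and K cbar alpha_star beta :: real
    and h :: "real \<Rightarrow> real"
  assumes "inventory_model M D X A K cbar h"
    and "0 \<le> alpha_star" and "alpha_star < 1"
    and "\<And>\<alpha>. \<alpha> \<in> {alpha_star<..1} \<Longrightarrow>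
           quasiconvex_on X (inventory_model.expected_h_disc M D cbar h \<alpha>)"
    and "\<And>\<alpha>. \<alpha> \<in> {alpha_star<..1} \<Longrightarrow>
           \<exists>L::ereal.
             ((\<lambda>x. ereal (inventory_model.expected_h_disc M D cbar h \<alpha> x)) \<longlongrightarrow> L)
               (inf at_bot (principal X)) \<and>
             L > ereal K + (INF x\<in>X. ereal (inventory_model.expected_h_disc M D cbar h \<alpha> x))"
    and "beta \<in> {alpha_star<..<1}"
  shows "equicontinuous_on X
           {inventory_model.u M D X A K cbar h \<alpha> | \<alpha>. \<alpha> \<in> {beta..<1}}"
proof -
  consider "X = UNIV" "A = {0..}" | "X = \<int>"
    using inventory_model.real_or_integer[OF assms(1)] by blast
  then show ?thesis
  proof cases
    case 1
    interpret real_inventory_model M D K cbar h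
      using assms(1) unfolding 1 real_inventory_model_def .
    \<comment> \<open>The interval is closed at 1 for the compactness argument, although the family
      in the conclusion has \<alpha> below 1.\<close>
    have sub: "\<alpha> \<in> {alpha_star<..1}" if "\<alpha> \<in> {beta..1}" for \<alpha>
      using that assms(6) by auto
    have quasiconvex: "quasiconvex_on UNIV (expected_h_disc \<alpha>)" if "\<alpha> \<in> {beta..1}" for \<alpha>
      using assms(4)[OF sub[OF that]] unfolding 1 .
    have profitable: "\<exists>b s. b < s \<and> K + expected_h_disc \<alpha> s < expected_h_disc \<alpha> b"
      if \<alpha>: "\<alpha> \<in> {beta..1}" for \<alpha>
    proof -
      obtain l where "((\<lambda>x. ereal (expected_h_disc \<alpha> x)) \<longlongrightarrow> l) at_bot"
          "l > ereal K + (INF x. ereal (expected_h_disc \<alpha> x))"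
        using assms(5)[OF sub[OF \<alpha>]] unfolding 1 by auto
      from setup_profitable[OF this] show ?thesis
        by blast
    qed
    show ?thesis
      unfolding 1
    proof (rule setup_profitable_uniform[OF _ quasiconvex profitable])
      show "beta \<le> 1"
        using assms(6) by simp
      fix b assume "\<And>\<alpha>. \<alpha> \<in> {beta..1} \<Longrightarrow> \<exists>s>b. K + expected_h_disc \<alpha> s < expected_h_disc \<alpha> b"
      then show "equicontinuous_on UNIV {u \<alpha> |\<alpha>. \<alpha> \<in> {beta..<1}}"
        using quasiconvex assms(2,6) by (intro equicontinuous_u[where b = b]) auto
    qed
  next
    case 2
    then show ?thesis by (simp add: equicontinuous_on_Ints)
  qed
qed

end
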